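(* Let $s\in\mathbb R$ and $p,q\in(0,+\infty]$. If the wavelet system $\{\psi^{(i)}_{j,k}\}$ satisfies the dyadic covering property, then the set of sequences of $b^{s,q}_p$ whose wavelet series is maximally divergent in $\mathbb R^d$ is residual in $b^{s,q}_p$, i.e. contains a countable intersection of dense open subsets of $b^{s,q}_p$.
   Context: Setting: integers $d,N\ge1$, bounded fast-decaying $\psi^{(1)},\dots,\psi^{(N)}:\mathbb R^d\to\mathbb C$, wavelets $\psi^{(i)}_{j,k}(x)=\psi^{(i)}(2^jx-k)$, $j\ge0$, $k\in\mathbb Z^d$; dyadic cubes $\lambda_{j,k}=\prod_{m=1}^d[k_m2^{-j},(k_m+1)2^{-j})$ of scale $j$; coefficients indexed by $(i,\lambda)$; $\Lambda_j$ = pairs $(i,\lambda)$ with $\lambda$ of scale $j$. $b^{s,q}_p$: sequences $(c^{(i)}_\lambda)$ with $\big(\big(\sum_{(i,\lambda)\in\Lambda_j}|c^{(i)}_\lambda2^{(s-d/p)j}|^p\big)^{1/p}\big)_{j\ge0}\in\ell^q$ (supremum if $p=\infty$), with the topology of the corresponding $\ell^q$ (quasi-)norm. Divergence exponent $\delta_{\mathcal C}(x)$: supremum of $\gamma$ such that there exist $C>0$ and $(i_n,j_n,k_n)$ with $j_n\to\infty$ and $|c^{(i_n)}_{j_n,k_n}\psi^{(i_n)}_{j_n,k_n}(x)|\ge C2^{\gamma j_n}$. Maximal divergence in a nonempty open $A$: (i) $\delta_{\mathcal C}(x)\in[-s,d/p-s]$ for all $x\in A$; (ii) $\delta_{\mathcal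 C}=-s$ a.e. on $A$; (iii) for every nonempty open $B\subset A$ and $\gamma\in[-s,d/p-s]$, $\dim_H\{x\in B:\delta_{\mathcal C}(x)=\gamma\}=d-sp-\gamma p$ (for $p=\infty$: $\delta_{\mathcal C}=-s$ on $A$). Dyadic covering property: there exist $C_0>0$ and finitely many triplets $(i_l,j_l,k_l)$ with $j_l\ge1$ such that every $x\in[0,1)^d$ has some $l$ with $|\psi^{(i_l)}(2^{j_l}x-k_l)|\ge C_0$. *)

theory Defs
  imports "HOL-Analysis.Analysis"
begin

text \<open>Wavelet index set: a finite type 'i (so N = CARD('i)); dimension d = CARD('d).
  Coefficients are functions c i j k, with j the scale and k in Z^d.\<close>

definition wav :: "('i \<Rightarrow> real^'d \<Rightarrow> complex) \<Rightarrow> 'i \<Rightarrow> nat \<Rightarrow> int^'d \<Rightarrow> real^'d \<Rightarrow> complex" where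
  "wav \<psi> i j k x = \<psi> i ((2::real) ^ j *\<^sub>R x - (\<chi> m. real_of_int (k $ m)))"

definition bounded_fast_decaying :: "('i \<Rightarrow> real^'d \<Rightarrow> complex) \<Rightarrow> bool" where
  "bounded_fast_decaying \<psi> \<longleftrightarrow>
     (\<exists>M. \<forall>i x. cmod (\<psi> i x) \<le> M) \<and>
     (\<forall>m::nat. \<exists>C. \<forall>i x. cmod (\<psi> i x) \<le> C / (1 + norm x) ^ m)"

definition dyadic_covering :: "('i \<Rightarrow> real^'d \<Rightarrow> complex) \<Rightarrow> bool" where
  "dyadic_covering \<psi> \<longleftrightarrow>
     (\<exists>C0 > 0. \<exists>T :: ('i \<times> nat \<times> (int^'d)) set. finite T \<and> (\<forall>(i,j,k)\<in>T. j \<ge> 1) \<and>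
        (\<forall>x::real^'d. (\<forall>m. 0 \<le> x $ m \<and> x $ m < 1) \<longrightarrow>
           (\<exists>(i,j,k)\<in>T. cmod (wav \<psi> i j k x) \<ge> C0)))"

text \<open>p-th power / root on extended nonnegative reals (r > 0).\<close>
definition enn_powr :: "ennreal \<Rightarrow> real \<Rightarrow> ennreal" where
  "enn_powr x r = (if x = \<infinity> then \<infinity> else ennreal (enn2real x powr r))"

definition d_over_p :: "'d::finite itself \<Rightarrow> ereal \<Rightarrow> real" where
  "d_over_p TYPE('d) p = (if p = \<infinity> then 0 else real CARD('d) / real_of_ereal p)"

definition layer :: "real \<Rightarrow> ereal \<Rightarrow> ('i \<Rightarrow> nat \<Rightarrow> int^'d::finite \<Rightarrow> complex) \<Rightarrow> nat \<Rightarrow> ennreal" where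
  "layer s p c j =
     (if p = \<infinity> then (SUP ik. ennreal (cmod (c (fst ik) j (snd ik)) * 2 powr (s * real j)))
      else enn_powr
        (\<integral>\<^sup>+ ik. ennreal ((cmod (c (fst ik) j (snd ik)) * 2 powr ((s - d_over_p TYPE('d) p) * real j))
                     powr real_of_ereal p) \<partial>count_space UNIV)
        (1 / real_of_ereal p))"

definition bnorm :: "real \<Rightarrow> ereal \<Rightarrow> ereal \<Rightarrow> ('i \<Rightarrow> nat \<Rightarrow> int^'d::finite \<Rightarrow> complex) \<Rightarrow> ennreal" where
  "bnorm s p q c =
     (if q = \<infinity> then (SUP j. layer s p c j)
      else enn_powr (\<Sum>j. enn_powr (layer s p c j) (real_of_ereal q)) (1 / real_of_ereal q))"

definition bspace :: "real \<Rightarrow> ereal \<Rightarrow> ereal \<Rightarrow> ('i \<Rightarrow> nat \<Rightarrow> int^'d::finite \<Rightarrow> complex) set" where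
  "bspace s p q = {c. bnorm s p q c < \<infinity>}"

definition b_open :: "real \<Rightarrow> ereal \<Rightarrow> ereal \<Rightarrow> ('i \<Rightarrow> nat \<Rightarrow> int^'d::finite \<Rightarrow> complex) set \<Rightarrow> bool" where
  "b_open s p q U \<longleftrightarrow> U \<subseteq> bspace s p q \<and>
     (\<forall>c\<in>U. \<exists>\<epsilon>>0. \<forall>c'\<in>bspace s p q. bnorm s p q (c' - c) < ennreal \<epsilon> \<longrightarrow> c' \<in> U)"

definition b_dense :: "real \<Rightarrow> ereal \<Rightarrow> ereal \<Rightarrow> ('i \<Rightarrow> nat \<Rightarrow> int^'d::finite \<Rightarrow> complex) set \<Rightarrow> bool" where
  "b_dense s p q D \<longleftrightarrow> D \<subseteq> bspace s p q \<and>
     (\<forall>c\<in>bspace s p q. \<forall>\<epsilon>>0. \<exists>c'\<in>D. bnorm s p q (c' - c) < ennreal \<epsilon>)"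

definition b_residual :: "real \<Rightarrow> ereal \<Rightarrow> ereal \<Rightarrow> ('i \<Rightarrow> nat \<Rightarrow> int^'d::finite \<Rightarrow> complex) set \<Rightarrow> bool" where
  "b_residual s p q S \<longleftrightarrow>
     (\<exists>G :: nat \<Rightarrow> _ set. (\<forall>n. b_open s p q (G n) \<and> b_dense s p q (G n)) \<and> (\<Inter>n. G n) \<subseteq> S)"

definition hausdorff_pre :: "real \<Rightarrow> real \<Rightarrow> 'a::metric_space set \<Rightarrow> ennreal" where
  "hausdorff_pre t \<delta> E = Inf {(\<Sum>n. ennreal (if U n = {} then 0 else if t = 0 then 1 else diameter (U n) powr t))
       | U. E \<subseteq> (\<Union>n. U n) \<and> (\<forall>n. bounded (U n) \<and> diameter (U n) \<le> \<delta>)}"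

definition hausdorff_measure :: "real \<Rightarrow> 'a::metric_space set \<Rightarrow> ennreal" where
  "hausdorff_measure t E = (SUP \<delta>\<in>{0<..}. hausdorff_pre t \<delta> E)"

definition dimH :: "'a::metric_space set \<Rightarrow> ereal" where
  "dimH E = (if E = {} then -\<infinity> else Inf (ereal ` {t. t \<ge> 0 \<and> hausdorff_measure t E = 0}))"

definition div_exp :: "('i \<Rightarrow> real^'d \<Rightarrow> complex) \<Rightarrow> ('i \<Rightarrow> nat \<Rightarrow> int^'d \<Rightarrow> complex) \<Rightarrow> real^'d \<Rightarrow> ereal" where
  "div_exp \<psi> c x = Sup {ereal \<gamma> | \<gamma>. \<exists>C>0. \<exists>I J K.
       filterlim J at_top sequentially \<and>
       (\<forall>n. cmod (c (I n) (J n) (K n) * wav \<psi> (I n) (J n) (K n) x) \<ge> C * 2 powr (\<gamma> * real (J n)))}"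

definition max_divergent :: "('i \<Rightarrow> real^'d::finite \<Rightarrow> complex) \<Rightarrow> real \<Rightarrow> ereal \<Rightarrow>
     ('i \<Rightarrow> nat \<Rightarrow> int^'d \<Rightarrow> complex) \<Rightarrow> (real^'d) set \<Rightarrow> bool" where
  "max_divergent \<psi> s p c A \<longleftrightarrow>
     (\<forall>x\<in>A. ereal (- s) \<le> div_exp \<psi> c x \<and> div_exp \<psi> c x \<le> ereal (d_over_p TYPE('d) p - s)) \<and>
     (AE x in lebesgue. x \<in> A \<longrightarrow> div_exp \<psi> c x = ereal (- s)) \<and>
     (if p = \<infinity> then (\<forall>x\<in>A. div_exp \<psi> c x = ereal (- s))
      else (\<forall>B. open B \<and> B \<noteq> {} \<and> B \<subseteq> A \<longrightarrow>
              (\<forall>\<gamma>. - s \<le> \<gamma> \<and> \<gamma> \<le> d_over_p TYPE('d) p - s \<longrightarrow>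
                 dimH {x\<in>B. div_exp \<psi> c x = ereal \<gamma>}
                   = ereal (real CARD('d) - s * real_of_ereal p - \<gamma> * real_of_ereal p))))"

end

(*
Write dp = d/p (0 for p = infinity), and beta in [0,1] for the parameter with gamma = -s + dp (1 - beta),
so that d - sp - gamma p = d beta.

Upper bounds hold for every c in the space: the coefficients satisfy |c| <= M 2^((dp-s)j), and by fast decay
{delta > gamma} is covered, from any scale on, by balls of radius 2^(-(1-eps)j) around the k 2^-j with
|c_(j,k)| >~ 2^(gamma j), whose number is controlled by the l^p norm of the layer.

Generic lower bounds: the n-th dense open set asks for a scale J >= n such that, for all j between J and nJ + 1,
the coefficients attached by the covering property to the cubes of side 2^-j with lower corner K 2^-J
(|K| <= n 2^J) exceed 2^((dp-s-1/n)j - dp J). There are about 2^(dJ) such cubes for each j, so a perturbation of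
norm O(2^(-J/n)) achieves this. Taking j = J gives delta >= -s everywhere. A point x whose binary digits vanish
at the positions in (J,j], with J/j close to beta, for infinitely many n, has delta(x) >= gamma. Spreading the
digits of y over the remaining positions gives a map f into this set of points, and the image of Lebesgue
measure under f has dimension d beta; since {delta > gamma} has smaller dimension, its preimage under f is
negligible, and so delta = gamma on a set of dimension at least d beta.
*)
theory Submission
  imports Defs
begin

section \<open>Besov sequence spaces\<close>

text \<open>The scale \<open>J n\<close> at which a sequence is enriched depends on the sequence,
  and nothing bounds the growth of \<open>J\<close>. The digits to be zeroed are therefore chosen
  only once the sequence is fixed, along a subsequence of n so sparse that earlier blocks hardly
  matter at the next one. One family of dense open sets has to serve all \<beta> at once; letting j
  run up to about nJ reaches every ratio J/j down to about 1/n, and thus also \<beta> = 0 in the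
  limit. The factor 2^(-j/n) makes the perturbation summable over scales for every q, and its effect
  on the exponent vanishes as n grows. No measure is put on the level sets of delta: the mass
  distribution principle is run on preimages under f, where \<open>negligible\<close> passes to
  subsets and countable unions without any measurability of delta. The covering bound gives {delta >
  gamma} dimension at most d \<beta>, not less; strictness comes from exhausting it by the sets
  {delta > gamma + 1/(k+1)}. At \<beta> = 0 measure says nothing, but there gamma is the largest
  possible exponent, so delta >= gamma is already equality.\<close>

lemma enn_powr_ennreal: "0 \<le> a \<Longrightarrow> enn_powr (ennreal a) r = ennreal (a powr r)"
  by (simp add: enn_powr_def)

lemma enn_powr_mono:
  assumes "x \<le> y" "0 \<le> r"
  shows "enn_powr x r \<le> enn_powr y r"
  using assms
  by (auto simp: enn_powr_def top_unique intro!: ennreal_leI powr_mono2 enn2real_mono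
      simp: less_top[symmetric])

lemma enn_powr_less_top_iff: "enn_powr x r < \<infinity> \<longleftrightarrow> x < \<infinity>"
  by (auto simp: enn_powr_def less_top)

lemma enn_powr_inverse: "0 < r \<Longrightarrow> enn_powr (enn_powr x r) (1 / r) = x"
  by (cases x rule: ennreal_cases) (auto simp: enn_powr_ennreal powr_powr, auto simp: enn_powr_def)

lemma enn_powr_inverse': "0 < r \<Longrightarrow> enn_powr (enn_powr x (1 / r)) r = x"
  by (cases x rule: ennreal_cases) (auto simp: enn_powr_ennreal powr_powr, auto simp: enn_powr_def)

text \<open>Bounding the sum by twice the maximum covers exponents below and above 1 at once; all
  that matters about the constant is that it does not depend on \<open>a\<close> and
  \<open>b\<close>.\<close>

lemma powr_add_le:
  fixes a b r :: real
  assumes "0 \<le> a" "0 \<le> b" "0 \<le> r"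
  shows "(a + b) powr r \<le> 2 powr r * (a powr r + b powr r)"
proof -
  have "(a + b) powr r \<le> (2 * max a b) powr r"
    using assms by (intro powr_mono2) auto
  also have "\<dots> = 2 powr r * max (a powr r) (b powr r)"
    using assms by (auto simp: powr_mult max_def powr_mono2 dest: powr_mono2[of r b a])
  also have "\<dots> \<le> 2 powr r * (a powr r + b powr r)"
    by (intro mult_left_mono) auto
  finally show ?thesis .
qed

lemma enn_powr_add_le:
  assumes "0 \<le> r"
  shows "enn_powr (x + y) r \<le> ennreal (2 powr r) * (enn_powr x r + enn_powr y r)"
proof (cases "x = \<infinity> \<or> y = \<infinity>")
  case True
  then show ?thesis by (auto simp: enn_powr_def ennreal_mult_top)
next
  case False
  then obtain a b where ab: "x = ennreal a" "0 \<le> a" "y = ennreal b" "0 \<le> b"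
    by (metis ennreal_cases infinity_ennreal_def)
  then have "enn_powr (x + y) r = ennreal ((a + b) powr r)"
    by (simp flip: ennreal_plus add: enn_powr_ennreal)
  also have "\<dots> \<le> ennreal (2 powr r * (a powr r + b powr r))"
    using ab assms by (intro ennreal_leI powr_add_le)
  finally show ?thesis
    using ab by (simp add: enn_powr_ennreal ennreal_mult ennreal_plus)
qed

lemma ereal_pos_cases:
  fixes p :: ereal
  assumes "0 < p"
  obtains (infinite) "p = \<infinity>" | (finite) r where "p = ereal r" "0 < r"
  using assms by (cases p) auto

lemma d_over_p_nonneg: "0 < p \<Longrightarrow> 0 \<le> d_over_p TYPE('d::finite) p"
  by (cases p rule: ereal_pos_cases) (auto simp: d_over_p_def)

lemma coefficient_le_layer:
  fixes c :: "'i \<Rightarrow> nat \<Rightarrow> int^'d::finite \<Rightarrow> complex"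
  assumes "0 < p"
  shows "ennreal (cmod (c i j k) * 2 powr ((s - d_over_p TYPE('d) p) * real j)) \<le> layer s p c j"
  using assms
proof (cases p rule: ereal_pos_cases)
  case infinite
  then show ?thesis
    by (auto simp: layer_def d_over_p_def intro!: SUP_upper2[of "(i, k)"])
next
  case (finite r)
  let ?w = "2 powr ((s - d_over_p TYPE('d) p) * real j)"
  let ?g = "\<lambda>ik. ennreal ((cmod (c (fst ik) j (snd ik)) * ?w) powr r)"
  have "ennreal (cmod (c i j k) * ?w) = enn_powr (?g (i, k)) (1 / r)"
    using \<open>0 < r\<close> by (simp add: enn_powr_ennreal powr_powr)
  also have "\<dots> \<le> enn_powr (\<integral>\<^sup>+ ik. ?g ik \<partial>count_space UNIV) (1 / r)"
    using \<open>0 < r\<close> by (intro enn_powr_mono nn_integral_ge_point) auto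
  finally show ?thesis
    using finite by (simp add: layer_def)
qed

lemma layer_le_bnorm:
  assumes "0 < q"
  shows "layer s p c j \<le> bnorm s p q c"
  using assms
proof (cases q rule: ereal_pos_cases)
  case infinite
  then show ?thesis by (auto simp: bnorm_def intro: SUP_upper)
next
  case (finite r)
  have "enn_powr (layer s p c j) r \<le> (\<Sum>j. enn_powr (layer s p c j) r)"
    using sum_le_suminf[of "\<lambda>j. enn_powr (layer s p c j) r" "{j}"] by simp
  then have "enn_powr (enn_powr (layer s p c j) r) (1 / r)
      \<le> enn_powr (\<Sum>j. enn_powr (layer s p c j) r) (1 / r)"
    using finite by (intro enn_powr_mono) auto
  then show ?thesis
    using finite by (simp add: bnorm_def enn_powr_inverse)
qed

text \<open>For p < 1 the layer is only a quasi-norm, so a constant is allowed. For finite p it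
  collects a factor 2 from the r-th powers of the coefficients and 2^(1/r) from splitting the root
  of the sum. It is uniform in the scale, as summation over scales requires.\<close>

lemma layer_add_le:
  assumes "0 < p"
  shows "\<exists>C\<ge>0. \<forall>(c :: 'i \<Rightarrow> nat \<Rightarrow> int^'d::finite \<Rightarrow> complex) c' j.
    layer s p c' j \<le> ennreal C * (layer s p c j + layer s p (c' - c) j)"
  using assms
proof (cases p rule: ereal_pos_cases)
  case infinite
  have "layer s p c' j \<le> layer s p c j + layer s p (c' - c) j"
    for c c' :: "'i \<Rightarrow> nat \<Rightarrow> int^'d \<Rightarrow> complex" and j
  proof -
    have "ennreal (cmod (c' i j k) * 2 powr (s * real j)) \<le> layer s p c j + layer s p (c' - c) j" for i k
    proof -
      have "cmod (c' i j k) \<le> cmod (c i j k) + cmod ((c' - c) i j k)"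
        using norm_triangle_ineq[of "c i j k" "(c' - c) i j k"] by simp
      then have "ennreal (cmod (c' i j k) * 2 powr (s * real j))
        \<le> ennreal (cmod (c i j k) * 2 powr (s * real j) + cmod ((c' - c) i j k) * 2 powr (s * real j))"
        by (simp del: fun_diff_def minus_apply flip: distrib_right)
      also have "\<dots> = ennreal (cmod (c i j k) * 2 powr (s * real j)) + ennreal (cmod ((c' - c) i j k) * 2 powr (s * real j))"
        by (intro ennreal_plus) auto
      also have "\<dots> \<le> layer s p c j + layer s p (c' - c) j"
        using infinite coefficient_le_layer[of p c i j k s] coefficient_le_layer[of p "c' - c" i j k s]
        by (intro add_mono) (auto simp: d_over_p_def)
      finally show ?thesis .
    qed
    then show ?thesis
      using infinite by (subst (1) layer_def) (auto intro!: SUP_least)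
  qed
  then show ?thesis by (intro exI[of _ 1]) auto
next
  case (finite r)
  have "layer s p c' j \<le> ennreal (2 * 2 powr (1 / r)) * (layer s p c j + layer s p (c' - c) j)"
    for c c' :: "'i \<Rightarrow> nat \<Rightarrow> int^'d \<Rightarrow> complex" and j
  proof -
    define w where "w = 2 powr ((s - d_over_p TYPE('d) p) * real j)"
    define e where "e = c' - c"
    define I where "I c = (\<integral>\<^sup>+ ik. ennreal ((cmod (c (fst ik) j (snd ik)) * w) powr r) \<partial>count_space UNIV)"
      for c :: "'i \<Rightarrow> nat \<Rightarrow> int^'d \<Rightarrow> complex"
    have L: "layer s p c j = enn_powr (I c) (1 / r)" for c
      using finite by (simp add: layer_def I_def w_def)
    have pt: "ennreal ((cmod (c' i j k) * w) powr r)
        \<le> ennreal (2 powr r) * (ennreal ((cmod (c i j k) * w) powr r) + ennreal ((cmod (e i j k) * w) powr r))" for i k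
    proof -
      have "cmod (c' i j k) \<le> cmod (c i j k) + cmod (e i j k)"
        using norm_triangle_ineq[of "c i j k" "e i j k"] by (simp add: e_def)
      then have "(cmod (c' i j k) * w) powr r \<le> (cmod (c i j k) * w + cmod (e i j k) * w) powr r"
        using \<open>0 < r\<close> by (intro powr_mono2) (auto simp flip: distrib_right simp: w_def)
      also have "\<dots> \<le> 2 powr r * ((cmod (c i j k) * w) powr r + (cmod (e i j k) * w) powr r)"
        using \<open>0 < r\<close> by (intro powr_add_le) (auto simp: w_def)
      finally show ?thesis
        by (simp flip: ennreal_plus ennreal_mult)
    qed
    have "I c' \<le> (\<integral>\<^sup>+ ik. ennreal (2 powr r) * (ennreal ((cmod (c (fst ik) j (snd ik)) * w) powr r)
        + ennreal ((cmod (e (fst ik) j (snd ik)) * w) powr r)) \<partial>count_space UNIV)"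
      unfolding I_def by (intro nn_integral_mono pt)
    also have "\<dots> = ennreal (2 powr r) * (I c + I e)"
      by (simp add: I_def nn_integral_cmult nn_integral_add)
    finally have "enn_powr (I c') (1 / r) \<le> enn_powr (ennreal (2 powr r) * (I c + I e)) (1 / r)"
      using \<open>0 < r\<close> by (intro enn_powr_mono) auto
    also have "\<dots> = ennreal 2 * enn_powr (I c + I e) (1 / r)"
    proof (cases "I c + I e" rule: ennreal_cases)
      case (real a)
      then show ?thesis
        using \<open>0 < r\<close>
        by (simp add: enn_powr_ennreal powr_mult powr_powr flip: ennreal_mult ennreal_numeral)
    next
      case top
      show ?thesis
        unfolding top by (simp add: enn_powr_def ennreal_mult_top)
    qed
    also have "\<dots> \<le> ennreal 2 * (ennreal (2 powr (1 / r)) * (enn_powr (I c) (1 / r) + enn_powr (I e) (1 / r)))"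
      using \<open>0 < r\<close> by (intro mult_left_mono enn_powr_add_le) auto
    finally show ?thesis
      unfolding L e_def by (simp add: ennreal_mult mult.assoc)
  qed
  then show ?thesis by (intro exI[of _ "2 * 2 powr (1 / r)"]) auto
qed

lemma bspace_perturb:
  fixes c c' :: "'i \<Rightarrow> nat \<Rightarrow> int^'d::finite \<Rightarrow> complex"
  assumes p: "0 < p" and q: "0 < q" and c: "c \<in> bspace s p q" and e: "c' - c \<in> bspace s p q"
  shows "c' \<in> bspace s p q"
proof -
  obtain C where C: "0 \<le> C"
    "\<And>j. layer s p c' j \<le> ennreal C * (layer s p c j + layer s p (c' - c) j)"
    using layer_add_le[OF p, where ?'i='i and ?'d='d] by metis
  show ?thesis
    using q
  proof (cases q rule: ereal_pos_cases)
    case infinite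
    have "layer s p c' j \<le> ennreal C * (bnorm s p q c + bnorm s p q (c' - c))" for j
      using C(2)[of j] layer_le_bnorm[OF q]
      by (meson add_mono mult_left_mono order_trans zero_le)
    then have "bnorm s p q c' \<le> ennreal C * (bnorm s p q c + bnorm s p q (c' - c))"
      using infinite by (subst (1) bnorm_def) (auto intro!: SUP_least)
    also have "\<dots> < \<infinity>"
      using c e by (auto simp: bspace_def ennreal_mult_less_top)
    finally show ?thesis by (simp add: bspace_def)
  next
    case (finite r)
    have step: "enn_powr (layer s p c' j) r \<le> ennreal (C powr r * 2 powr r)
        * (enn_powr (layer s p c j) r + enn_powr (layer s p (c' - c) j) r)" for j
    proof -
      have "layer s p c j + layer s p (c' - c) j < \<infinity>"
        using layer_le_bnorm[OF q, of s p c j] layer_le_bnorm[OF q, of s p "c' - c" j] c e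
        by (auto simp: bspace_def)
      then obtain a where a: "layer s p c j + layer s p (c' - c) j = ennreal a" "0 \<le> a"
        by (metis ennreal_cases infinity_ennreal_def less_irrefl)
      have "enn_powr (layer s p c' j) r \<le> enn_powr (ennreal (C * a)) r"
        using C(1) C(2)[of j] a finite by (intro enn_powr_mono) (auto simp: ennreal_mult)
      also have "\<dots> = ennreal (C powr r) * enn_powr (layer s p c j + layer s p (c' - c) j) r"
        using a C(1) by (simp add: enn_powr_ennreal powr_mult flip: ennreal_mult)
      also have "\<dots> \<le> ennreal (C powr r) * (ennreal (2 powr r)
          * (enn_powr (layer s p c j) r + enn_powr (layer s p (c' - c) j) r))"
        using finite by (intro mult_left_mono enn_powr_add_le) auto
      finally show ?thesis by (simp add: ennreal_mult mult.assoc)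
    qed
    have fin: "(\<Sum>j. enn_powr (layer s p a j) r) < \<infinity>" if "a \<in> bspace s p q" for a :: "'i \<Rightarrow> nat \<Rightarrow> int^'d \<Rightarrow> complex"
      using that finite unfolding bspace_def bnorm_def by (simp add: enn_powr_less_top_iff[unfolded infinity_ennreal_def])
    have "(\<Sum>j. enn_powr (layer s p c' j) r) \<le> (\<Sum>j. ennreal (C powr r * 2 powr r)
        * (enn_powr (layer s p c j) r + enn_powr (layer s p (c' - c) j) r))"
      by (intro suminf_le step) auto
    also have "\<dots> = ennreal (C powr r * 2 powr r)
        * ((\<Sum>j. enn_powr (layer s p c j) r) + (\<Sum>j. enn_powr (layer s p (c' - c) j) r))"
      by (simp add: ennreal_suminf_cmult suminf_add)
    also have "\<dots> < \<infinity>"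
      using fin[OF c] fin[OF e] by (auto simp: ennreal_mult_less_top)
    finally show ?thesis
      using finite by (simp add: bspace_def bnorm_def enn_powr_less_top_iff[unfolded infinity_ennreal_def])
  qed
qed

text \<open>A geometric sequence lies in every l^q, so decay of the layers removes the dependence on
  \<open>q\<close> from later estimates: \<open>B\<close> is fixed by \<open>q\<close> and \<rho>,
  and smallness is left to \<open>A\<close>.\<close>

lemma bnorm_geometric_bound:
  assumes q: "0 < q" and \<rho>: "0 < \<rho>" "\<rho> < 1"
  shows "\<exists>B>0. \<forall>(e :: 'i \<Rightarrow> nat \<Rightarrow> int^'d::finite \<Rightarrow> complex) A. 0 \<le> A \<longrightarrow>
    (\<forall>j. layer s p e j \<le> ennreal (A * \<rho> ^ j)) \<longrightarrow> bnorm s p q e \<le> ennreal (A * B)"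
  using q
proof (cases q rule: ereal_pos_cases)
  case infinite
  have "bnorm s p q e \<le> ennreal (A * 1)"
    if "0 \<le> A" "\<forall>j. layer s p e j \<le> ennreal (A * \<rho> ^ j)"
    for e :: "'i \<Rightarrow> nat \<Rightarrow> int^'d \<Rightarrow> complex" and A
  proof -
    have "layer s p e j \<le> ennreal A" for j
      using that(1) that(2)[rule_format, of j] \<rho>
      by (smt (verit, best) ennreal_leI mult_left_le order_trans power_le_one)
    then show ?thesis using infinite by (auto simp: bnorm_def intro!: SUP_least)
  qed
  then show ?thesis by (intro exI[of _ 1]) auto
next
  case (finite r)
  define S where "S = 1 / (1 - \<rho> powr r)"
  have \<rho>r: "0 < \<rho> powr r" "\<rho> powr r < 1"
    using \<rho> finite powr_less_mono2[of r \<rho> 1] by auto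
  then have S: "0 < S" by (simp add: S_def)
  have "bnorm s p q e \<le> ennreal (A * S powr (1 / r))"
    if A: "0 \<le> A" and le: "\<forall>j. layer s p e j \<le> ennreal (A * \<rho> ^ j)"
    for e :: "'i \<Rightarrow> nat \<Rightarrow> int^'d \<Rightarrow> complex" and A
  proof -
    have "enn_powr (layer s p e j) r \<le> ennreal (A powr r * (\<rho> powr r) ^ j)" for j
    proof -
      have "enn_powr (layer s p e j) r \<le> enn_powr (ennreal (A * \<rho> ^ j)) r"
        using le finite by (intro enn_powr_mono) auto
      also have "\<dots> = ennreal (A powr r * (\<rho> powr r) ^ j)"
        using A \<rho> by (simp add: enn_powr_ennreal powr_mult powr_powr mult.commute flip: powr_realpow)
      finally show ?thesis .
    qed
    then have "(\<Sum>j. enn_powr (layer s p e j) r) \<le> (\<Sum>j. ennreal (A powr r * (\<rho> powr r) ^ j))"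
      by (intro suminf_le) auto
    also have "\<dots> = ennreal (A powr r * S)"
      using \<rho>r by (intro suminf_ennreal_eq sums_mult) (auto simp: S_def intro: geometric_sums)
    finally have "bnorm s p q e \<le> enn_powr (ennreal (A powr r * S)) (1 / r)"
      using finite by (simp add: bnorm_def enn_powr_mono)
    also have "\<dots> = ennreal (A * S powr (1 / r))"
      using A S finite by (simp add: enn_powr_ennreal powr_mult powr_powr)
    finally show ?thesis .
  qed
  then show ?thesis using S by (intro exI[of _ "S powr (1 / r)"]) auto
qed

text \<open>The exponent is 1/p, and 0 when p is infinite, so one formula covers both cases. The
  bound \<open>1 \<le> N\<close> keeps clear of \<open>0 powr 0 = 0\<close> for infinite p.\<close>

lemma layer_finite_support_le:
  fixes e :: "'i \<Rightarrow> nat \<Rightarrow> int^'d::finite \<Rightarrow> complex"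
  assumes p: "0 < p" and S: "finite S" "\<And>i k. (i, k) \<notin> S \<Longrightarrow> e i j k = 0"
    and N: "real (card S) \<le> N" "1 \<le> N"
    and a: "\<And>i k. cmod (e i j k) * 2 powr ((s - d_over_p TYPE('d) p) * real j) \<le> a"
  shows "layer s p e j \<le> ennreal (N powr (d_over_p TYPE('d) p / real CARD('d)) * a)"
  using p
proof (cases p rule: ereal_pos_cases)
  case infinite
  then show ?thesis
    using a N by (auto simp: layer_def d_over_p_def intro!: SUP_least ennreal_leI)
next
  case (finite r)
  let ?w = "2 powr ((s - d_over_p TYPE('d) p) * real j)"
  have a0: "0 \<le> a"
    using a[of undefined undefined] by (meson mult_nonneg_nonneg norm_ge_zero order_trans powr_ge_zero)
  have "(\<integral>\<^sup>+ ik. ennreal ((cmod (e (fst ik) j (snd ik)) * ?w) powr r) \<partial>count_space UNIV)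
      \<le> (\<integral>\<^sup>+ ik. ennreal (a powr r) * indicator S ik \<partial>count_space UNIV)"
    using a S(2) finite
    by (intro nn_integral_mono) (auto simp: indicator_def intro!: ennreal_leI powr_mono2)
  also have "\<dots> = ennreal (a powr r * real (card S))"
    using S(1) by (simp add: nn_integral_cmult_indicator ennreal_mult ennreal_of_nat_eq_real_of_nat)
  also have "\<dots> \<le> ennreal (a powr r * N)"
    using N by (intro ennreal_leI mult_left_mono) auto
  finally have "layer s p e j \<le> enn_powr (ennreal (a powr r * N)) (1 / r)"
    using finite by (simp add: layer_def enn_powr_mono)
  also have "\<dots> = ennreal (N powr (1 / r) * a)"
    using a0 N finite by (simp add: enn_powr_ennreal powr_mult powr_powr mult.commute)
  finally show ?thesis using finite by (simp add: d_over_p_def)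
qed

section \<open>Hausdorff measures and dyadic cubes\<close>

abbreviation hausdorff_cost :: "real \<Rightarrow> 'a::metric_space set \<Rightarrow> ennreal" where
  "hausdorff_cost t U \<equiv> ennreal (if U = {} then 0 else if t = 0 then 1 else diameter U powr t)"

lemma hausdorff_pre_le_countable:
  fixes V :: "'b::countable \<Rightarrow> 'a::metric_space set"
  assumes "E \<subseteq> (\<Union>a. V a)" "\<And>a. bounded (V a) \<and> diameter (V a) \<le> \<delta>" "0 \<le> \<delta>"
  shows "hausdorff_pre t \<delta> E \<le> (\<integral>\<^sup>+ a. hausdorff_cost t (V a) \<partial>count_space UNIV)"
proof -
  define U where "U n = (if n \<in> range (to_nat :: 'b \<Rightarrow> nat) then V (from_nat n) else {})" for n
  have U: "U (to_nat a) = V a" for a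
    by (simp add: U_def)
  have "E \<subseteq> (\<Union>n. U n)"
    using assms(1) unfolding U[symmetric] by blast
  moreover have "\<forall>n. bounded (U n) \<and> diameter (U n) \<le> \<delta>"
    using assms(2,3) by (auto simp: U_def)
  ultimately have "hausdorff_pre t \<delta> E \<le> (\<Sum>n. hausdorff_cost t (U n))"
    unfolding hausdorff_pre_def by (intro Inf_lower CollectI exI[of _ U] conjI refl) auto
  also have "\<dots> = (\<integral>\<^sup>+ n. hausdorff_cost t (U n) \<partial>count_space UNIV)"
    by (rule nn_integral_count_space_nat[symmetric])
  also have "\<dots> = (\<integral>\<^sup>+ n. hausdorff_cost t (U n) \<partial>count_space (range (to_nat :: 'b \<Rightarrow> nat)))"
    by (subst nn_integral_count_space_indicator, simp)
      (auto intro!: nn_integral_cong simp: indicator_def U_def)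
  also have "\<dots> = (\<integral>\<^sup>+ a. hausdorff_cost t (U (to_nat (a :: 'b))) \<partial>count_space UNIV)"
    by (rule nn_integral_bij_count_space[symmetric]) (simp add: bij_betw_def)
  also have "\<dots> = (\<integral>\<^sup>+ a. hausdorff_cost t (V a) \<partial>count_space UNIV)"
    unfolding U ..
  finally show ?thesis .
qed

lemma finite_vec_set: "finite A \<Longrightarrow> finite {v :: 'a^'d::finite. \<forall>m. v $ m \<in> A}"
  and card_vec_set: "finite A \<Longrightarrow> card {v :: 'a^'d::finite. \<forall>m. v $ m \<in> A} = card A ^ CARD('d)"
proof -
  assume A: "finite A"
  have bij: "bij_betw vec_nth {v :: 'a^'d. \<forall>m. v $ m \<in> A} (UNIV \<rightarrow>\<^sub>E A)"
    by (intro bij_betwI[of _ _ _ vec_lambda]) (auto simp: PiE_def Pi_def)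
  show "finite {v :: 'a^'d. \<forall>m. v $ m \<in> A}"
    using bij_betw_finite[OF bij] A by (simp add: finite_PiE)
  show "card {v :: 'a^'d. \<forall>m. v $ m \<in> A} = card A ^ CARD('d)"
    using bij_betw_same_card[OF bij] by (simp add: card_PiE)
qed

text \<open>The half-open cube of side 2^-m with lower corner K 2^-m. Floors are used because
  \<lfloor>2^m x\<rfloor> is the truncated binary expansion that the digit maps prescribe.\<close>

definition dyadic_cube :: "nat \<Rightarrow> int^'d \<Rightarrow> (real^'d) set" where
  "dyadic_cube m K = {x. \<forall>i. \<lfloor>2 ^ m * x $ i\<rfloor> = K $ i}"

lemma dyadic_cube_subset_cbox:
  "dyadic_cube m K \<subseteq> cbox (\<chi> i. K $ i / 2 ^ m) (\<chi> i. (K $ i + 1) / 2 ^ m)"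
proof
  fix x assume x: "x \<in> dyadic_cube m K"
  have "K $ i / 2 ^ m \<le> x $ i \<and> x $ i \<le> (K $ i + 1) / 2 ^ m" for i
    using x floor_correct[of "2 ^ m * x $ i"]
    by (simp add: dyadic_cube_def pos_divide_le_eq pos_le_divide_eq mult.commute)
  then show "x \<in> cbox (\<chi> i. K $ i / 2 ^ m) (\<chi> i. (K $ i + 1) / 2 ^ m)"
    by (simp add: mem_box_cart)
qed

lemma emeasure_dyadic_cbox:
  fixes K :: "int^'d::finite"
  shows "emeasure lborel (cbox (\<chi> i. K $ i / 2 ^ m) (\<chi> i. (K $ i + 1) / 2 ^ m)) =
    ennreal ((1 / 2 ^ m) ^ CARD('d))"
proof -
  let ?l = "(\<chi> i. K $ i / 2 ^ m) :: real^'d" and ?u = "(\<chi> i. (K $ i + 1) / 2 ^ m) :: real^'d"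
  have side: "(?u - ?l) \<bullet> b = 1 / 2 ^ m" if b: "b \<in> Basis" for b
  proof -
    obtain i where "b = axis i 1"
      using b by (auto simp: Basis_vec_def)
    then show ?thesis
      by (simp add: inner_axis add_divide_distrib)
  qed
  have "?l \<bullet> b \<le> ?u \<bullet> b" if "b \<in> Basis" for b
  proof -
    have "0 \<le> (?u - ?l) \<bullet> b" unfolding side[OF that] by simp
    then show ?thesis unfolding inner_diff_left by linarith
  qed
  then have "emeasure lborel (cbox ?l ?u) = ennreal (\<Prod>b\<in>Basis. (?u - ?l) \<bullet> b)"
    by (rule emeasure_lborel_cbox)
  also have "(\<Prod>b\<in>Basis. (?u - ?l) \<bullet> b) = (\<Prod>b\<in>(Basis :: (real^'d) set). 1 / 2 ^ m)"
    by (intro prod.cong refl side)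
  also have "\<dots> = (1 / 2 ^ m) ^ CARD('d)"
    by (simp only: prod_constant DIM_cart DIM_real mult_1_right)
  finally show ?thesis .
qed

text \<open>Numbers at distance at most 1 have floors that differ by at most 1. The 3^d neighbours
  of one cube therefore suffice, and mass bounds on cubes pass to arbitrary small sets up to a
  constant.\<close>

lemma diameter_small_cover:
  fixes U :: "(real^'d::finite) set"
  assumes "bounded U" "diameter U \<le> 1 / 2 ^ m" "x \<in> U"
  shows "U \<subseteq> (\<Union>e \<in> {e. \<forall>i. e $ i \<in> {-1, 0, 1}}. dyadic_cube m ((\<chi> i. \<lfloor>2 ^ m * x $ i\<rfloor>) + e))"
proof
  fix y assume y: "y \<in> U"
  have "\<bar>2 ^ m * y $ i - 2 ^ m * x $ i\<bar> \<le> 1" for i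
  proof -
    have "\<bar>y $ i - x $ i\<bar> \<le> norm (y - x)"
      using component_le_norm_cart[of "y - x" i] by simp
    also have "\<dots> \<le> 1 / 2 ^ m"
      using diameter_bounded_bound[OF assms(1) y assms(3)] assms(2) by (simp add: dist_norm)
    finally have "2 ^ m * \<bar>y $ i - x $ i\<bar> \<le> 1"
      by (simp add: field_simps)
    also have "2 ^ m * \<bar>y $ i - x $ i\<bar> = \<bar>2 ^ m * y $ i - 2 ^ m * x $ i\<bar>"
      by (simp add: abs_mult flip: right_diff_distrib)
    finally show ?thesis .
  qed
  note close = this
  define e where "e = (\<chi> i. \<lfloor>2 ^ m * y $ i\<rfloor> - \<lfloor>2 ^ m * x $ i\<rfloor>)"
  have "e $ i \<in> {-1, 0, 1}" for i
  proof -
    have "2 ^ m * y $ i \<le> 2 ^ m * x $ i + 1" "2 ^ m * x $ i \<le> 2 ^ m * y $ i + 1"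
      using close[of i] unfolding abs_le_iff by linarith+
    then have "\<lfloor>2 ^ m * y $ i\<rfloor> \<le> \<lfloor>2 ^ m * x $ i + 1\<rfloor>" "\<lfloor>2 ^ m * x $ i\<rfloor> \<le> \<lfloor>2 ^ m * y $ i + 1\<rfloor>"
      by (blast intro: floor_mono)+
    then have "\<bar>e $ i\<bar> \<le> 1"
      unfolding e_def one_add_floor[symmetric] by simp
    then show ?thesis by (cases "e $ i < 0") auto
  qed
  then have e: "e \<in> {e. \<forall>i. e $ i \<in> {-1, 0, 1}}"
    by (intro CollectI allI)
  have "y \<in> dyadic_cube m ((\<chi> i. \<lfloor>2 ^ m * x $ i\<rfloor>) + e)"
    by (simp add: dyadic_cube_def e_def)
  with e show "y \<in> (\<Union>e \<in> {e. \<forall>i. e $ i \<in> {-1, 0, 1}}. dyadic_cube m ((\<chi> i. \<lfloor>2 ^ m * x $ i\<rfloor>) + e))"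
    by (rule UN_I)
qed

text \<open>Mass distribution principle, phrased through a map \<open>f\<close> instead of a measure: the image of
  Lebesgue measure under \<open>f\<close> gives mass at most \<open>C 2\<^sup>-\<^sup>t\<^sup>m\<close> to each dyadic cube of scale \<open>m\<close>.\<close>

lemma negligible_vimage_hausdorff_null:
  fixes f :: "real^'d::finite \<Rightarrow> real^'d"
  assumes t: "0 < t" and H: "hausdorff_measure t E = 0"
    and cube: "\<And>m K. \<exists>L. f -` dyadic_cube m K \<subseteq> dyadic_cube (r m) L"
    and r: "\<And>m. (1 / 2 ^ r m) ^ CARD('d) \<le> C * 2 powr (- t * real m)" and C: "0 < C"
  shows "negligible (f -` E)"
proof -
  define S where "S = {e :: int^'d. \<forall>i. e $ i \<in> {-1, 0, 1}}"
  have S: "finite S" unfolding S_def by (intro finite_vec_set) auto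
  \<comment> \<open>Adding 1 makes \<open>N\<close> positive without evaluating
    \<open>card S\<close>, which is 3^d.\<close>
  define N where "N = real (card S) + 1"
  have N: "0 < N" by (simp add: N_def)
  have level: "\<exists>A\<in>sets lborel. f -` U \<subseteq> A \<and> emeasure lborel A \<le> ennreal (N * C * 2 powr (- t * real m))"
    if U: "bounded U" "diameter U \<le> 1 / 2 ^ m" for U m
  proof (cases "U = {}")
    case False
    then obtain x where x: "x \<in> U" by auto
    define k where "k = (\<chi> i. \<lfloor>2 ^ m * x $ i\<rfloor>)"
    obtain L where L: "\<And>K. f -` dyadic_cube m K \<subseteq> dyadic_cube (r m) (L K)"
      using cube by metis
    define Q where "Q e = cbox (\<chi> i. L (k + e) $ i / 2 ^ r m) (\<chi> i. (L (k + e) $ i + 1) / 2 ^ r m)"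
      for e :: "int^'d"
    have "U \<subseteq> (\<Union>e\<in>S. dyadic_cube m (k + e))"
      using diameter_small_cover[OF U x] unfolding S_def k_def .
    then have "f -` U \<subseteq> (\<Union>e\<in>S. f -` dyadic_cube m (k + e))"
      unfolding vimage_UN[symmetric] by (rule vimage_mono)
    also have "\<dots> \<subseteq> (\<Union>e\<in>S. Q e)"
      unfolding Q_def by (intro UN_mono order_refl order_trans[OF L dyadic_cube_subset_cbox])
    finally have "f -` U \<subseteq> (\<Union>e\<in>S. Q e)" .
    moreover have "emeasure lborel (\<Union>e\<in>S. Q e) \<le> ennreal (N * C * 2 powr (- t * real m))"
    proof -
      have "emeasure lborel (\<Union>e\<in>S. Q e) \<le> (\<Sum>e\<in>S. emeasure lborel (Q e))"
        using S by (intro emeasure_subadditive_finite) (auto simp: Q_def)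
      also have "\<dots> = ennreal (real (card S) * (1 / 2 ^ r m) ^ CARD('d))"
        unfolding Q_def emeasure_dyadic_cbox
        by (simp add: ennreal_mult ennreal_of_nat_eq_real_of_nat)
      also have "\<dots> \<le> ennreal (N * (C * 2 powr (- t * real m)))"
        using r[of m] N by (intro ennreal_leI mult_mono) (auto simp: N_def)
      finally show ?thesis by (simp add: mult.assoc)
    qed
    moreover have "(\<Union>e\<in>S. Q e) \<in> sets lborel"
      using S by (intro sets.finite_UN) (auto simp: Q_def)
    ultimately show ?thesis by blast
  qed (auto intro!: bexI[of _ "{}"])
  \<comment> \<open>The factor 2^t pays for rounding a diameter up to a power of 2.\<close>
  define D where "D = N * C * 2 powr t"
  have D: "0 < D" using N C by (simp add: D_def)
  \<comment> \<open>Sets of diameter 0 cost nothing, yet their preimages are only known to lie in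
    sets of arbitrarily small measure; the slack \<eta> accounts for them.\<close>
  have cover: "\<exists>A\<in>sets lborel. f -` U \<subseteq> A \<and> emeasure lborel A \<le> ennreal D * hausdorff_cost t U + ennreal \<eta>"
    if U: "bounded U" "diameter U \<le> 1" and \<eta>: "0 < \<eta>" for U \<eta>
  proof (cases "diameter U = 0")
    case True
    have "(\<lambda>m. N * C * 2 powr (- t * real m)) \<longlonglongrightarrow> N * C * 0"
    proof -
      have "(\<lambda>m. (2 powr - t) ^ m) \<longlonglongrightarrow> 0"
        using t by (intro LIMSEQ_realpow_zero) (auto simp: powr_minus field_simps)
      then show ?thesis
        by (intro tendsto_intros) (simp add: powr_powr flip: powr_realpow)
    qed
    then have "\<forall>\<^sub>F m in sequentially. N * C * 2 powr (- t * real m) < \<eta>"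
      using \<eta> by (intro order_tendstoD) auto
    then obtain m where "N * C * 2 powr (- t * real m) < \<eta>"
      by (auto simp: eventually_sequentially)
    then have "ennreal (N * C * 2 powr (- t * real m)) \<le> ennreal D * hausdorff_cost t U + ennreal \<eta>"
      by (intro add_increasing ennreal_leI) auto
    moreover have "diameter U \<le> 1 / 2 ^ m" using True by simp
    ultimately show ?thesis
      using level[OF U(1)] by (meson order_trans)
  next
    case False
    then have d: "0 < diameter U" and ne: "U \<noteq> {}"
      using diameter_ge_0[OF U(1)] by auto
    \<comment> \<open>The finest scale whose cubes still have side at least the diameter of
      \<open>U\<close>.\<close>
    define m where "m = nat \<lfloor>- log 2 (diameter U)\<rfloor>"
    have lg: "log 2 (diameter U) \<le> 0" using d U(2) by simp
    then have m: "real m \<le> - log 2 (diameter U)" "- log 2 (diameter U) < real m + 1"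
      by (auto simp: m_def)
    have "diameter U = 2 powr (log 2 (diameter U))" using d by simp
    also have "\<dots> \<le> 2 powr (- real m)" using m by (intro powr_mono) auto
    also have "\<dots> = 1 / 2 ^ m" by (simp add: powr_minus powr_realpow divide_inverse)
    finally obtain A where A: "A \<in> sets lborel" "f -` U \<subseteq> A"
        "emeasure lborel A \<le> ennreal (N * C * 2 powr (- t * real m))"
      using level[OF U(1)] by blast
    have "2 powr (- t * real m) \<le> 2 powr (t + t * log 2 (diameter U))"
    proof (intro powr_mono)
      have "t * (- real m) \<le> t * (1 + log 2 (diameter U))" using m t by (intro mult_left_mono) auto
      then show "- t * real m \<le> t + t * log 2 (diameter U)" by (simp add: algebra_simps)
    qed auto
    also have "\<dots> = 2 powr t * diameter U powr t"
    proof -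
      have "2 powr (t * log 2 (diameter U)) = (2 powr (log 2 (diameter U))) powr t"
        by (simp only: powr_powr mult.commute)
      then show ?thesis using d by (simp add: powr_add)
    qed
    finally have le: "N * C * 2 powr (- t * real m) \<le> D * diameter U powr t"
      using N C by (simp add: D_def mult.assoc)
    have "emeasure lborel A \<le> ennreal D * hausdorff_cost t U"
    proof -
      have "emeasure lborel A \<le> ennreal (D * diameter U powr t)"
        using A(3) le by (rule order_trans[OF _ ennreal_leI])
      then show ?thesis using D ne t by (simp add: ennreal_mult)
    qed
    also have "\<dots> \<le> ennreal D * hausdorff_cost t U + ennreal \<eta>"
      by simp
    finally show ?thesis
      using A(1,2) by blast
  qed
  have "\<exists>T. f -` E \<subseteq> T \<and> T \<in> lmeasurable \<and> measure lebesgue T \<le> \<eta>" if \<eta>: "0 < \<eta>" for \<eta>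
  proof -
    have "hausdorff_pre t 1 E \<le> hausdorff_measure t E"
      unfolding hausdorff_measure_def by (intro SUP_upper) auto
    then have "hausdorff_pre t 1 E < ennreal (\<eta> / (2 * D))"
      using H \<eta> D by simp
    then obtain U :: "nat \<Rightarrow> (real^'d) set" where U: "E \<subseteq> (\<Union>n. U n)" "\<And>n. bounded (U n) \<and> diameter (U n) \<le> 1"
      "(\<Sum>n. hausdorff_cost t (U n)) < ennreal (\<eta> / (2 * D))"
      unfolding hausdorff_pre_def Inf_less_iff by blast
    \<comment> \<open>Half of \<eta> pays for the cost of the cover, the other half is spread
      geometrically over the slacks.\<close>
    have "\<exists>A\<in>sets lborel. f -` U n \<subseteq> A \<and>
        emeasure lborel A \<le> ennreal D * hausdorff_cost t (U n) + ennreal (\<eta> / 2 * (1 / 2) ^ Suc n)" for n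
      using U(2) \<eta> by (intro cover) auto
    then obtain A where A: "\<And>n. A n \<in> sets lborel" "\<And>n. f -` U n \<subseteq> A n"
      "\<And>n. emeasure lborel (A n) \<le> ennreal D * hausdorff_cost t (U n) + ennreal (\<eta> / 2 * (1 / 2) ^ Suc n)"
      by metis
    have "emeasure lborel (\<Union>n. A n) \<le> (\<Sum>n. emeasure lborel (A n))"
      using A(1) by (intro emeasure_subadditive_countably) auto
    also have "\<dots> \<le> (\<Sum>n. ennreal D * hausdorff_cost t (U n) + ennreal (\<eta> / 2 * (1 / 2) ^ Suc n))"
      by (intro suminf_le A) auto
    also have "\<dots> = ennreal D * (\<Sum>n. hausdorff_cost t (U n)) + (\<Sum>n. ennreal (\<eta> / 2 * (1 / 2) ^ Suc n))"
      by (simp only: suminf_add[symmetric] ennreal_suminf_cmult summableI)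
    also have "(\<Sum>n. ennreal (\<eta> / 2 * (1 / 2) ^ Suc n)) = ennreal (\<eta> / 2 * 1)"
      using \<eta> by (intro suminf_ennreal_eq sums_mult power_half_series) auto
    also have "ennreal D * (\<Sum>n. hausdorff_cost t (U n)) \<le> ennreal D * ennreal (\<eta> / (2 * D))"
      using U(3) by (intro mult_left_mono) auto
    also have "ennreal D * ennreal (\<eta> / (2 * D)) + ennreal (\<eta> / 2 * 1) = ennreal \<eta>"
      using D \<eta> by (simp flip: ennreal_mult ennreal_plus)
    finally have le: "emeasure lborel (\<Union>n. A n) \<le> ennreal \<eta>" by (simp add: add_mono)
    have sets: "(\<Union>n. A n) \<in> sets lborel" using A(1) by auto
    then have eq: "emeasure lebesgue (\<Union>n. A n) = emeasure lborel (\<Union>n. A n)" by simp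
    have "f -` E \<subseteq> (\<Union>n. A n)" using U(1) A(2) by blast
    moreover have "(\<Union>n. A n) \<in> lmeasurable"
      using sets le eq by (intro fmeasurableI) (auto intro: le_less_trans)
    moreover have "measure lebesgue (\<Union>n. A n) \<le> \<eta>"
      using le eq \<eta> by (simp add: measure_def enn2real_leI)
    ultimately show ?thesis by blast
  qed
  then show ?thesis by (simp add: negligible_outer_le)
qed

section \<open>Upper bounds for the divergence exponent\<close>

lemma eventually_powr_decay:
  fixes \<theta> A \<eta> :: real
  assumes "0 < \<theta>" "0 < \<eta>"
  shows "\<forall>\<^sub>F j in sequentially. A * 2 powr (- \<theta> * real j) < \<eta>"
proof -
  have "(\<lambda>j. (2 powr - \<theta>) ^ j) \<longlonglongrightarrow> 0"
    using assms by (intro LIMSEQ_realpow_zero) (auto simp: powr_minus field_simps)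
  then have "(\<lambda>j. A * 2 powr (- \<theta> * real j)) \<longlonglongrightarrow> A * 0"
    by (intro tendsto_intros) (simp add: powr_powr flip: powr_realpow)
  then show ?thesis
    using assms by (intro order_tendstoD) auto
qed

lemma div_exp_geI:
  fixes \<psi> :: "'i \<Rightarrow> real^'d::finite \<Rightarrow> complex"
  assumes C: "0 < C"
    and large: "\<And>j0. \<exists>j\<ge>j0. \<exists>i k. C * 2 powr (\<gamma> * real j) \<le> cmod (c i j k * wav \<psi> i j k x)"
  shows "ereal \<gamma> \<le> div_exp \<psi> c x"
proof -
  obtain J I K where J: "\<And>n. n \<le> J n"
    "\<And>n. C * 2 powr (\<gamma> * real (J n)) \<le> cmod (c (I n) (J n) (K n) * wav \<psi> (I n) (J n) (K n) x)"
    using large by metis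
  have "filterlim J at_top sequentially"
    using J(1) by (intro filterlim_at_top_mono[OF filterlim_ident]) auto
  then show ?thesis
    unfolding div_exp_def using C J(2) by (intro Sup_upper CollectI exI[of _ \<gamma>] conjI refl exI[of _ C] exI[of _ I] exI[of _ J] exI[of _ K] allI)
qed

text \<open>Some exponent \<gamma>' above \<gamma> occurs in the supremum, and C 2^(\<gamma>' j)
  exceeds 2^(\<gamma> j) for large j; this is why no constant is left in the conclusion.\<close>

lemma div_exp_gtD:
  fixes \<psi> :: "'i \<Rightarrow> real^'d::finite \<Rightarrow> complex"
  assumes "ereal \<gamma> < div_exp \<psi> c x"
  shows "\<exists>j\<ge>j0. \<exists>i k. 2 powr (\<gamma> * real j) \<le> cmod (c i j k * wav \<psi> i j k x)"
proof -
  define P where "P g \<longleftrightarrow> (\<exists>C>0. \<exists>I J K. filterlim J at_top sequentially \<and>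
    (\<forall>n. cmod (c (I n) (J n) (K n) * wav \<psi> (I n) (J n) (K n) x) \<ge> C * 2 powr (g * real (J n))))" for g
  have "div_exp \<psi> c x = Sup {ereal g | g. P g}"
    unfolding div_exp_def P_def ..
  then obtain \<gamma>' where \<gamma>': "P \<gamma>'" "\<gamma> < \<gamma>'"
    using assms unfolding less_Sup_iff by (auto simp: less_Sup_iff)
  then obtain C I J K where g: "\<gamma> < \<gamma>'" "0 < C" and J: "filterlim J at_top sequentially"
    and le: "\<And>n. C * 2 powr (\<gamma>' * real (J n)) \<le> cmod (c (I n) (J n) (K n) * wav \<psi> (I n) (J n) (K n) x)"
    unfolding P_def by blast
  have "\<forall>\<^sub>F j in sequentially. 1 * 2 powr (- (\<gamma>' - \<gamma>) * real j) < C"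
    using g by (intro eventually_powr_decay) auto
  then have "\<forall>\<^sub>F n in sequentially. 1 * 2 powr (- (\<gamma>' - \<gamma>) * real (J n)) < C"
    using J by (rule eventually_compose_filterlim)
  moreover have "\<forall>\<^sub>F n in sequentially. j0 \<le> J n"
    using J unfolding filterlim_at_top by blast
  ultimately have "\<forall>\<^sub>F n in sequentially. 1 * 2 powr (- (\<gamma>' - \<gamma>) * real (J n)) < C \<and> j0 \<le> J n"
    by (rule eventually_conj)
  then obtain n where n: "2 powr (- (\<gamma>' - \<gamma>) * real (J n)) < C" "j0 \<le> J n"
    by (auto simp: eventually_sequentially)
  have "2 powr (\<gamma> * real (J n)) = 2 powr (- (\<gamma>' - \<gamma>) * real (J n)) * 2 powr (\<gamma>' * real (J n))"
    by (simp add: algebra_simps flip: powr_add)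
  also have "\<dots> \<le> C * 2 powr (\<gamma>' * real (J n))"
    using n by (intro mult_right_mono) auto
  finally show ?thesis
    using le[of n] n(2) by (meson order_trans)
qed

lemma bspace_coefficient_bound:
  fixes c :: "'i \<Rightarrow> nat \<Rightarrow> int^'d::finite \<Rightarrow> complex"
  assumes p: "0 < p" and q: "0 < q" and c: "c \<in> bspace s p q"
  shows "\<exists>M>0. (\<forall>j. layer s p c j \<le> ennreal M) \<and>
    (\<forall>i j k. cmod (c i j k) \<le> M * 2 powr ((d_over_p TYPE('d) p - s) * real j))"
proof -
  define N where "N = enn2real (bnorm s p q c)"
  have N: "0 \<le> N" "bnorm s p q c = ennreal N" using c by (auto simp: N_def bspace_def)
  have le: "layer s p c j \<le> ennreal (N + 1)" for j
    using layer_le_bnorm[OF q, of s p c j] N by (metis ennreal_leI le_add_same_cancel1 order_trans zero_le_one)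
  have "cmod (c i j k) \<le> (N + 1) * 2 powr ((d_over_p TYPE('d) p - s) * real j)" for i j k
  proof -
    let ?e = "(s - d_over_p TYPE('d) p) * real j"
    have "ennreal (cmod (c i j k) * 2 powr ?e) \<le> ennreal (N + 1)"
      using coefficient_le_layer[OF p, of c i j k s] le order_trans by blast
    then have "cmod (c i j k) * 2 powr ?e \<le> N + 1"
      using N by (subst (asm) ennreal_le_iff) auto
    then have "cmod (c i j k) * 2 powr ?e * 2 powr (- ?e) \<le> (N + 1) * 2 powr (- ?e)"
      by (intro mult_right_mono) auto
    then show ?thesis
      by (simp add: mult.assoc algebra_simps flip: powr_add)
  qed
  then show ?thesis using N(1) le by (intro exI[of _ "N + 1"]) auto
qed

lemma bounded_fast_decaying_bound:
  assumes "bounded_fast_decaying \<psi>"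
  shows "\<exists>B>0. \<forall>i x. cmod (\<psi> i x) \<le> B"
proof -
  obtain M where "\<And>i x. cmod (\<psi> i x) \<le> M"
    using assms by (auto simp: bounded_fast_decaying_def)
  then have "cmod (\<psi> i x) \<le> max M 1" for i x by (meson max.coboundedI1)
  then show ?thesis by (intro exI[of _ "max M 1"]) auto
qed

text \<open>A single term of scale j has modulus at most M B 2^((dp - s) j), so no larger exponent
  survives at large scales.\<close>

lemma div_exp_le:
  fixes \<psi> :: "'i \<Rightarrow> real^'d::finite \<Rightarrow> complex"
  assumes p: "0 < p" and q: "0 < q" and c: "c \<in> bspace s p q" and \<psi>: "bounded_fast_decaying \<psi>"
  shows "div_exp \<psi> c x \<le> ereal (d_over_p TYPE('d) p - s)"
proof (rule ccontr)
  let ?g = "d_over_p TYPE('d) p - s"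
  obtain M where M: "0 < M" "\<And>j. layer s p c j \<le> ennreal M"
    "\<And>i j k. cmod (c i j k) \<le> M * 2 powr (?g * real j)"
    using bspace_coefficient_bound[OF p q c] by blast
  obtain B where B: "0 < B" "\<And>i x. cmod (\<psi> i x) \<le> B"
    using bounded_fast_decaying_bound[OF \<psi>] by blast
  assume "\<not> div_exp \<psi> c x \<le> ereal ?g"
  then obtain g where "ereal ?g < g" "g < div_exp \<psi> c x" 
    using dense[of "ereal ?g" "div_exp \<psi> c x"] unfolding not_le by blast
  then obtain \<gamma> where \<gamma>: "?g < \<gamma>" "ereal \<gamma> < div_exp \<psi> c x" by (cases g) auto
  have "\<forall>\<^sub>F j in sequentially. (M * B) * 2 powr (- (\<gamma> - ?g) * real j) < 1"
    using \<gamma> by (intro eventually_powr_decay) auto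
  then obtain j0 where j0: "\<And>j. j0 \<le> j \<Longrightarrow> (M * B) * 2 powr (- (\<gamma> - ?g) * real j) < 1"
    by (auto simp: eventually_sequentially)
  obtain j i k where j: "j0 \<le> j" "2 powr (\<gamma> * real j) \<le> cmod (c i j k * wav \<psi> i j k x)"
    using div_exp_gtD[OF \<gamma>(2)] by blast
  have "cmod (c i j k * wav \<psi> i j k x) \<le> (M * 2 powr (?g * real j)) * B"
    unfolding norm_mult wav_def using M(1) by (intro mult_mono B M(3)) auto
  with j(2) have "2 powr (\<gamma> * real j) \<le> (M * 2 powr (?g * real j)) * B"
    by (rule order_trans)
  also have "\<dots> = ((M * B) * 2 powr (- (\<gamma> - ?g) * real j)) * 2 powr (\<gamma> * real j)"
    by (simp add: mult.assoc algebra_simps flip: powr_add)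
  also have "\<dots> < 1 * 2 powr (\<gamma> * real j)"
    using j0[OF j(1)] by (intro mult_strict_right_mono) auto
  finally show False by simp
qed

lemma nn_integral_layer_le:
  fixes c :: "'i \<Rightarrow> nat \<Rightarrow> int^'d::finite \<Rightarrow> complex"
  assumes "p = ereal r" "0 < r" "layer s p c j \<le> ennreal M" "0 \<le> M"
  shows "(\<integral>\<^sup>+ ik. ennreal ((cmod (c (fst ik) j (snd ik)) * 2 powr ((s - d_over_p TYPE('d) p) * real j)) powr r)
    \<partial>count_space UNIV) \<le> ennreal (M powr r)"
proof -
  let ?I = "\<integral>\<^sup>+ ik. ennreal ((cmod (c (fst ik) j (snd ik)) * 2 powr ((s - d_over_p TYPE('d) p) * real j)) powr r)
    \<partial>count_space UNIV"
  have "?I = enn_powr (layer s p c j) r"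
    using assms by (simp add: layer_def enn_powr_inverse')
  also have "\<dots> \<le> enn_powr (ennreal M) r"
    using assms by (intro enn_powr_mono) auto
  finally show ?thesis using assms by (simp add: enn_powr_ennreal)
qed

text \<open>By fast decay, a large term at scale \<open>j\<close> forces \<open>x\<close> to lie within \<open>2\<^sup>-\<^sup>(\<^sup>1\<^sup>-\<^sup>\<epsilon>\<^sup>)\<^sup>j\<close> of \<open>k 2\<^sup>-\<^sup>j\<close> for some
  large coefficient; Chebyshev's inequality bounds the cost of these balls by the layer.\<close>

lemma hausdorff_null_div_exp_gt:
  fixes \<psi> :: "'i::finite \<Rightarrow> real^'d::finite \<Rightarrow> complex"
  assumes p: "p = ereal r" "0 < r" and q: "0 < q" and c: "c \<in> bspace s p q"
    and \<psi>: "bounded_fast_decaying \<psi>"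
    and t: "0 < t" "real CARD('d) - s * r - \<gamma> * r < t"
  shows "hausdorff_measure t {x. ereal \<gamma> < div_exp \<psi> c x} = 0"
proof -
  have p0: "0 < p" using p by simp
  define dp where "dp = d_over_p TYPE('d) p"
  have dp: "dp * r = real CARD('d)" using p by (simp add: dp_def d_over_p_def)
  define D where "D = real CARD('d) - s * r - \<gamma> * r"
  \<comment> \<open>A ball of radius 2^(-(1-\<epsilon>)j) costs about 2^(-t(1-\<epsilon>)j); this
    choice keeps t(1-\<epsilon>) - D at least (t-D)/2. The minimum with 1/2 ensures \<epsilon> < 1,
    as \<open>D\<close> may be negative.\<close>
  define \<epsilon> where "\<epsilon> = min (1 / 2) ((t - D) / (2 * t))"
  have \<epsilon>: "0 < \<epsilon>" "\<epsilon> < 1" using t by (auto simp: \<epsilon>_def D_def)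
  define \<kappa> where "\<kappa> = t * (1 - \<epsilon>) - D"
  have "t * \<epsilon> \<le> t * ((t - D) / (2 * t))" using t by (intro mult_left_mono) (auto simp: \<epsilon>_def)
  also have "\<dots> = (t - D) / 2" using t by simp
  finally have \<kappa>: "0 < \<kappa>" using t(2) by (simp add: \<kappa>_def D_def algebra_simps)
  obtain M where M: "0 < M" "\<And>j. layer s p c j \<le> ennreal M"
    "\<And>i j k. cmod (c i j k) \<le> M * 2 powr ((dp - s) * real j)"
    using bspace_coefficient_bound[OF p0 q c] unfolding dp_def by blast
  obtain B where B: "0 < B" "\<And>i x. cmod (\<psi> i x) \<le> B"
    using bounded_fast_decaying_bound[OF \<psi>] by blast
  \<comment> \<open>The order of decay: at distance 2^(\<epsilon>j) in rescaled coordinates the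
    wavelet loses 2^(-\<epsilon>mj), which outweighs the bound on the coefficients.\<close>
  obtain m :: nat where m: "(dp - s - \<gamma>) / \<epsilon> < real m" using reals_Archimedean2 by blast
  define \<theta> where "\<theta> = \<gamma> - (dp - s - \<epsilon> * real m)"
  have \<theta>: "0 < \<theta>" using m \<epsilon> by (simp add: \<theta>_def pos_divide_less_eq mult.commute)
  obtain Cm where Cm: "\<And>i x. cmod (\<psi> i x) \<le> Cm / (1 + norm x) ^ m"
    using \<psi> unfolding bounded_fast_decaying_def by metis
  have Cm0: "0 \<le> Cm" using Cm[of undefined 0] by (simp add: order_trans[OF norm_ge_zero])
  obtain j1 where j1: "\<And>j. j1 \<le> j \<Longrightarrow> (M * Cm) * 2 powr (- \<theta> * real j) < 1"
    using eventually_powr_decay[OF \<theta> zero_less_one, of "M * Cm"] by (auto simp: eventually_sequentially)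
  define \<rho> where "\<rho> j = 2 powr (- (1 - \<epsilon>) * real j)" for j
  \<comment> \<open>Indices with too small a coefficient get the empty set, so the cover is indexed
    by all of the index type and its cost is a sum over the whole layer.\<close>
  define V where "V j ik = (if 2 powr (\<gamma> * real j) \<le> B * cmod (c (fst ik) j (snd ik))
    then cball ((1 / 2 ^ j) *\<^sub>R (\<chi> i. real_of_int (snd ik $ i))) (\<rho> j) else {})" for j ik

  have in_V: "x \<in> V j (i, k)" if j: "j1 \<le> j" and large: "2 powr (\<gamma> * real j) \<le> cmod (c i j k * wav \<psi> i j k x)" for j i k x
  proof -
    define v where "v = 2 ^ j *\<^sub>R x - (\<chi> i. real_of_int (k $ i))"
    have eq: "cmod (c i j k * wav \<psi> i j k x) = cmod (c i j k) * cmod (\<psi> i v)"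
      by (simp add: norm_mult wav_def v_def)
    have "cmod (c i j k) * cmod (\<psi> i v) \<le> cmod (c i j k) * B"
      by (intro mult_left_mono B) auto
    then have big: "2 powr (\<gamma> * real j) \<le> B * cmod (c i j k)"
      using large eq by (simp add: mult.commute)
    have "norm v < 2 powr (\<epsilon> * real j)"
    proof (rule ccontr)
      assume "\<not> norm v < 2 powr (\<epsilon> * real j)"
      then have "(2 powr (\<epsilon> * real j)) ^ m \<le> (1 + norm v) ^ m" by (intro power_mono) auto
      then have "Cm / (1 + norm v) ^ m \<le> Cm / (2 powr (\<epsilon> * real j)) ^ m"
        using Cm0 by (intro divide_left_mono mult_pos_pos zero_less_power) (auto simp: add_pos_nonneg)
      also have "(2 powr (\<epsilon> * real j)) ^ m = 2 powr (\<epsilon> * real m * real j)"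
        by (simp add: powr_power mult_ac)
      also have "Cm / 2 powr (\<epsilon> * real m * real j) = Cm * 2 powr (- (\<epsilon> * real m * real j))"
        by (simp add: powr_minus divide_inverse)
      finally have "cmod (\<psi> i v) \<le> Cm * 2 powr (- (\<epsilon> * real m * real j))"
        using Cm[of i v] by linarith
      then have "cmod (c i j k) * cmod (\<psi> i v)
          \<le> (M * 2 powr ((dp - s) * real j)) * (Cm * 2 powr (- (\<epsilon> * real m * real j)))"
        using M by (intro mult_mono) auto
      also have "\<dots> = ((M * Cm) * 2 powr (- \<theta> * real j)) * 2 powr (\<gamma> * real j)"
        by (simp add: \<theta>_def algebra_simps flip: powr_add)
      also have "\<dots> < 1 * 2 powr (\<gamma> * real j)"
        using j1[OF j] by (intro mult_strict_right_mono) auto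
      finally show False using large eq by simp
    qed
    then have "norm v / 2 ^ j \<le> 2 powr (\<epsilon> * real j) / 2 ^ j"
      by (intro divide_right_mono) auto
    also have "\<dots> = \<rho> j"
      by (simp add: \<rho>_def algebra_simps powr_diff powr_realpow)
    also have "norm v / 2 ^ j = dist ((1 / 2 ^ j) *\<^sub>R (\<chi> i. real_of_int (k $ i))) x"
    proof -
      have "x - (1 / 2 ^ j) *\<^sub>R (\<chi> i. real_of_int (k $ i)) = (1 / 2 ^ j) *\<^sub>R v"
        by (simp add: v_def scaleR_diff_right)
      then have "dist x ((1 / 2 ^ j) *\<^sub>R (\<chi> i. real_of_int (k $ i))) = norm v / 2 ^ j"
        by (simp add: dist_norm)
      then show ?thesis by (simp add: dist_commute)
    qed
    finally show ?thesis using big by (simp add: V_def)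
  qed

  define A where "A = 2 powr t * B powr r * M powr r"
  have A: "0 < A" using B M by (simp add: A_def)
  have cost: "(\<integral>\<^sup>+ ik. hausdorff_cost t (V j ik) \<partial>count_space UNIV) \<le> ennreal (A * 2 powr (- \<kappa> * real j))" for j
  proof -
    define w where "w = 2 powr ((s - dp) * real j)"
    define a where "a = 2 powr t * B powr r * 2 powr (- \<kappa> * real j)"
    have "hausdorff_cost t (V j ik) \<le> ennreal a * ennreal ((cmod (c (fst ik) j (snd ik)) * w) powr r)" for ik
    proof (cases "2 powr (\<gamma> * real j) \<le> B * cmod (c (fst ik) j (snd ik))")
      case True
      let ?c = "cmod (c (fst ik) j (snd ik))"
      have \<rho>: "0 < \<rho> j" by (simp add: \<rho>_def)
      have "(2 powr (\<gamma> * real j)) powr r \<le> (B * ?c) powr r"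
        using True p by (intro powr_mono2) auto
      then have "2 powr (\<gamma> * real j * r) * 2 powr (- (\<gamma> * real j * r))
          \<le> (B * ?c) powr r * 2 powr (- (\<gamma> * real j * r))"
        unfolding powr_powr by (rule mult_right_mono) simp
      \<comment> \<open>Multiplying the cost of each selected ball by this factor turns the count of
        balls into the l^r sum of the layer.\<close>
      then have chebyshev: "1 \<le> (B * ?c) powr r * 2 powr (- (\<gamma> * r * real j))"
        by (simp add: mult_ac flip: powr_add)
      have "diameter (V j ik) powr t = (2 * \<rho> j) powr t"
        using True \<rho> by (simp add: V_def diameter_cball)
      also have "\<dots> = 2 powr t * 2 powr (- (t * (1 - \<epsilon>) * real j))"
        by (simp add: \<rho>_def powr_mult powr_powr algebra_simps)
      also have "\<dots> \<le> 2 powr t * 2 powr (- (t * (1 - \<epsilon>) * real j)) * ((B * ?c) powr r * 2 powr (- (\<gamma> * r * real j)))"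
        using mult_left_mono[OF chebyshev, of "2 powr t * 2 powr (- (t * (1 - \<epsilon>) * real j))"] by simp
      also have "\<dots> = a * (?c * w) powr r"
      proof -
        have e: "- (t * (1 - \<epsilon>) * real j) - \<gamma> * r * real j = - \<kappa> * real j + (s - dp) * real j * r"
          using dp by (simp add: \<kappa>_def D_def algebra_simps)
        have "2 powr (- (t * (1 - \<epsilon>) * real j)) * 2 powr (- (\<gamma> * r * real j))
            = 2 powr (- \<kappa> * real j) * 2 powr ((s - dp) * real j * r)"
          unfolding powr_add[symmetric] using e by simp
        then show ?thesis
          using B(1) by (simp add: a_def w_def powr_mult powr_powr mult_ac)
      qed
      finally have "diameter (V j ik) powr t \<le> a * (?c * w) powr r" .
      moreover have "0 \<le> a" by (simp add: a_def)
      ultimately show ?thesis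
        using t(1) by (simp add: ennreal_leI flip: ennreal_mult)
    next
      case False
      then show ?thesis by (simp add: V_def)
    qed
    then have "(\<integral>\<^sup>+ ik. hausdorff_cost t (V j ik) \<partial>count_space UNIV)
        \<le> (\<integral>\<^sup>+ ik. ennreal a * ennreal ((cmod (c (fst ik) j (snd ik)) * w) powr r) \<partial>count_space UNIV)"
      by (rule nn_integral_mono)
    also have "\<dots> = ennreal a * (\<integral>\<^sup>+ ik. ennreal ((cmod (c (fst ik) j (snd ik)) * w) powr r) \<partial>count_space UNIV)"
      by (simp add: nn_integral_cmult)
    also have "\<dots> \<le> ennreal a * ennreal (M powr r)"
      using nn_integral_layer_le[OF p M(2)] M(1) unfolding w_def dp_def by (intro mult_left_mono) auto
    also have "\<dots> = ennreal (A * 2 powr (- \<kappa> * real j))"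
      by (simp add: A_def a_def ac_simps flip: ennreal_mult)
    finally show ?thesis .
  qed

  have pre_le: "hausdorff_pre t \<delta> {x. ereal \<gamma> < div_exp \<psi> c x} \<le> ennreal \<eta>" if \<delta>: "0 < \<delta>" and \<eta>: "0 < \<eta>" for \<delta> \<eta>
  proof -
    \<comment> \<open>Geometric series over the scales: everything from scale \<open>J\<close> on
      costs at most A G 2^(-\<kappa> J).\<close>
    define G where "G = 1 / (1 - 2 powr - \<kappa>)"
    have lt1: "2 powr - \<kappa> < 1" using \<kappa> by (simp add: powr_minus field_simps)
    have "\<forall>\<^sub>F j in sequentially. 2 * 2 powr (- (1 - \<epsilon>) * real j) < \<delta>"
      using \<epsilon> \<delta> by (intro eventually_powr_decay) auto
    moreover have "\<forall>\<^sub>F j in sequentially. (A * G) * 2 powr (- \<kappa> * real j) < \<eta>"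
      using \<kappa> \<eta> by (intro eventually_powr_decay) auto
    ultimately have "\<forall>\<^sub>F j in sequentially. 2 * \<rho> j < \<delta> \<and> (A * G) * 2 powr (- \<kappa> * real j) < \<eta> \<and> j1 \<le> j"
      unfolding \<rho>_def by (intro eventually_conj eventually_ge_at_top)
    then obtain J where J': "\<forall>j\<ge>J. 2 * \<rho> j < \<delta> \<and> (A * G) * 2 powr (- \<kappa> * real j) < \<eta> \<and> j1 \<le> j"
      unfolding eventually_sequentially by (elim exE)
    then have J: "\<And>j. J \<le> j \<Longrightarrow> 2 * \<rho> j < \<delta>" "(A * G) * 2 powr (- \<kappa> * real J) < \<eta>" "j1 \<le> J"
      by simp_all
    define W where "W = (\<lambda>(j, ik). V (J + j) ik)"
    have "hausdorff_pre t \<delta> {x. ereal \<gamma> < div_exp \<psi> c x} \<le> (\<integral>\<^sup>+ a. hausdorff_cost t (W a) \<partial>count_space UNIV)"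
    proof (rule hausdorff_pre_le_countable)
      show "{x. ereal \<gamma> < div_exp \<psi> c x} \<subseteq> (\<Union>a. W a)"
      proof safe
        fix x assume "ereal \<gamma> < div_exp \<psi> c x"
        from div_exp_gtD[OF this, of J] obtain j i k where
          j: "J \<le> j" "2 powr (\<gamma> * real j) \<le> cmod (c i j k * wav \<psi> i j k x)" by blast
        then have "x \<in> V j (i, k)" using J(3) by (intro in_V) auto
        then have "x \<in> W (j - J, (i, k))" using j(1) by (simp add: W_def)
        then show "x \<in> (\<Union>a. W a)" by blast
      qed
      show "bounded (W a) \<and> diameter (W a) \<le> \<delta>" for a
      proof -
        obtain j ik where Pair: "a = (j, ik)" by (cases a) auto
        have "0 < \<rho> (J + j)" by (simp add: \<rho>_def)
        then show ?thesis using J(1)[of "J + j"] \<delta> Pair by (simp add: W_def V_def diameter_cball)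
      qed
    qed (use \<delta> in auto)
    also have "\<dots> = (\<integral>\<^sup>+ j. \<integral>\<^sup>+ ik. hausdorff_cost t (W (j, ik)) \<partial>count_space UNIV \<partial>count_space UNIV)"
      by (rule nn_integral_fst_count_space[symmetric])
    also have "\<dots> = (\<Sum>j. \<integral>\<^sup>+ ik. hausdorff_cost t (V (J + j) ik) \<partial>count_space UNIV)"
      unfolding W_def prod.case by (rule nn_integral_count_space_nat)
    also have "\<dots> \<le> (\<Sum>j. ennreal (A * 2 powr (- \<kappa> * real (J + j))))"
      by (intro suminf_le cost) auto
    also have "\<dots> = (\<Sum>j. ennreal (A * 2 powr (- \<kappa> * real J) * (2 powr - \<kappa>) ^ j))"
    proof -
      have "2 powr (- \<kappa> * real (J + j)) = 2 powr (- \<kappa> * real J) * (2 powr - \<kappa>) ^ j" for j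
        by (simp add: powr_power algebra_simps flip: powr_add)
      then show ?thesis by (simp only: mult.assoc)
    qed
    also have "\<dots> = ennreal (A * 2 powr (- \<kappa> * real J) * G)"
      using A lt1 unfolding G_def by (intro suminf_ennreal_eq sums_mult geometric_sums) auto
    also have "\<dots> \<le> ennreal \<eta>"
      using J(2) by (intro ennreal_leI) (simp add: mult_ac)
    finally show ?thesis .
  qed
  have "hausdorff_pre t \<delta> {x. ereal \<gamma> < div_exp \<psi> c x} \<le> 0" if "0 < \<delta>" for \<delta>
    by (rule ennreal_le_epsilon) (simp add: pre_le that)
  then have "hausdorff_measure t {x. ereal \<gamma> < div_exp \<psi> c x} \<le> 0"
    unfolding hausdorff_measure_def by (intro SUP_least) simp
  then show ?thesis by simp
qed

section \<open>The generic sequences\<close>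

text \<open>The corners K with K 2^-J in [-n,n]^d. The truncation keeps each enrichment condition
  finite, and any given point is eventually inside.\<close>

definition dyadic_box :: "nat \<Rightarrow> nat \<Rightarrow> (int^'d) set" where
  "dyadic_box n J = {K. \<forall>m. K $ m \<in> {- (int n * 2 ^ J)..int n * 2 ^ J}}"

text \<open>The wavelet (l, k) on the unit cube, transported to the cube \<open>K\<close> of scale
  j, becomes the wavelet of scale j + l with this index: its value at x is that of (l, k) at 2^j x -
  K.\<close>

definition covering_index :: "int^'d \<Rightarrow> nat \<Rightarrow> int^'d \<Rightarrow> int^'d" where
  "covering_index k l K = (\<chi> m. 2 ^ l * K $ m + k $ m)"

text \<open>The indices of the wavelets that, by the covering property, are large somewhere on the small cubes of
  scale \<open>j \<in> {J..n * J + 1}\<close> whose lower corner \<open>K 2\<^sup>-\<^sup>J\<close> is a dyadic point of the coarser scale \<open>J\<close>.\<close>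

definition enriched_indices :: "('i \<times> nat \<times> (int^'d)) set \<Rightarrow> nat \<Rightarrow> nat \<Rightarrow> ('i \<times> nat \<times> (int^'d)) set" where
  "enriched_indices T n J = (\<lambda>((i, l, k), j, K). (i, j + l, covering_index k l (\<chi> m. 2 ^ (j - J) * K $ m)))
     ` (T \<times> {J..n * J + 1} \<times> dyadic_box n J)"

text \<open>With about 2^(dJ) coefficients of this size at scale j, the factor 2^(-dp J) offsets
  their number and leaves a layer of order 2^(-j/n).\<close>

definition enrichment_level :: "real \<Rightarrow> real \<Rightarrow> nat \<Rightarrow> nat \<Rightarrow> nat \<Rightarrow> real" where
  "enrichment_level s dp n J j = 2 powr ((dp - s - 1 / real n) * real j - dp * real J)"

definition enriched_at :: "('i \<times> nat \<times> (int^'d::finite)) set \<Rightarrow> real \<Rightarrow> real \<Rightarrow> nat \<Rightarrow> nat \<Rightarrow>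
    ('i \<Rightarrow> nat \<Rightarrow> int^'d \<Rightarrow> complex) \<Rightarrow> bool" where
  "enriched_at T s dp n J c \<longleftrightarrow>
     (\<forall>(i, j, k) \<in> enriched_indices T n J. enrichment_level s dp n J j < cmod (c i j k))"

definition enriched :: "('i \<times> nat \<times> (int^'d::finite)) set \<Rightarrow> real \<Rightarrow> ereal \<Rightarrow> ereal \<Rightarrow> nat \<Rightarrow>
    ('i \<Rightarrow> nat \<Rightarrow> int^'d \<Rightarrow> complex) set" where
  "enriched T s p q n = {c \<in> bspace s p q. \<exists>J\<ge>n. enriched_at T s (d_over_p TYPE('d) p) n J c}"

section \<open>Openness and density of the enriched sets\<close>

lemma finite_dyadic_box: "finite (dyadic_box n J :: (int^'d::finite) set)"
  unfolding dyadic_box_def by (intro finite_vec_set) auto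

lemma card_dyadic_box_le:
  assumes "1 \<le> n"
  shows "real (card (dyadic_box n J :: (int^'d::finite) set)) \<le> (3 * real n * 2 ^ J) ^ CARD('d)"
proof -
  have one: "1 \<le> real n * 2 ^ J"
    using mult_mono[of 1 "real n" 1 "2 ^ J"] assms by simp
  have "card {- (int n * 2 ^ J)..int n * 2 ^ J} = 2 * n * 2 ^ J + 1"
    by (simp add: nat_add_distrib nat_mult_distrib nat_power_eq)
  then have "real (card (dyadic_box n J :: (int^'d) set)) = (2 * real n * 2 ^ J + 1) ^ CARD('d)"
    unfolding dyadic_box_def by (subst card_vec_set) (auto simp: add.commute)
  also have "\<dots> \<le> (3 * real n * 2 ^ J) ^ CARD('d)"
    using one by (intro power_mono) auto
  finally show ?thesis .
qed

lemma finite_enriched_indices: "finite T \<Longrightarrow> finite (enriched_indices T n J)"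
  unfolding enriched_indices_def by (intro finite_imageI finite_cartesian_product finite_dyadic_box) auto

lemma enriched_indices_scale: "(i, j, k) \<in> enriched_indices T n J \<Longrightarrow> J \<le> j"
  by (auto simp: enriched_indices_def)

text \<open>At a fixed scale \<open>j\<close> the triplet and the corner determine the index, since
  the cube must have scale \<open>j - l\<close>. The count is therefore of order 2^(dJ), whatever
  \<open>j\<close> is.\<close>

lemma enriched_indices_layer:
  fixes T :: "('i \<times> nat \<times> (int^'d::finite)) set" and j J n :: nat
  assumes T: "finite T" and n: "1 \<le> n"
  defines "S \<equiv> {(i, k). (i, j, k) \<in> enriched_indices T n J}"
  shows "finite S" "real (card S) \<le> real (card T + 1) * (3 * real n * 2 ^ J) ^ CARD('d)"
proof -
  define g where "g = (\<lambda>((i :: 'i, l, k :: int^'d), K). (i, covering_index k l (\<chi> m. 2 ^ (j - l - J) * K $ m)))"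
  have sub: "S \<subseteq> g ` (T \<times> dyadic_box n J)"
  proof
    fix a assume "a \<in> S"
    then obtain i l k j' K where "(i, l, k) \<in> T" "K \<in> dyadic_box n J" "j = j' + l"
      "a = (i, covering_index k l (\<chi> m. 2 ^ (j' - J) * K $ m))"
      unfolding S_def enriched_indices_def by auto
    then show "a \<in> g ` (T \<times> dyadic_box n J)"
      by (intro image_eqI[of _ _ "((i, l, k), K)"]) (auto simp: g_def)
  qed
  have fin: "finite (T \<times> (dyadic_box n J :: (int^'d) set))"
    using T finite_dyadic_box by (rule finite_cartesian_product)
  then show "finite S" using sub finite_subset by blast
  have "card S \<le> card (T \<times> (dyadic_box n J :: (int^'d) set))"
    using surj_card_le[OF fin sub] .
  then have "real (card S) \<le> real (card T) * real (card (dyadic_box n J :: (int^'d) set))"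
    by (simp add: card_cartesian_product flip: of_nat_mult)
  also have "\<dots> \<le> real (card T + 1) * (3 * real n * 2 ^ J) ^ CARD('d)"
    using card_dyadic_box_le[OF n] by (intro mult_mono) auto
  finally show "real (card S) \<le> real (card T + 1) * (3 * real n * 2 ^ J) ^ CARD('d)" .
qed

lemma b_open_enriched:
  fixes T :: "('i \<times> nat \<times> (int^'d::finite)) set"
  assumes p: "0 < p" and q: "0 < q" and T: "finite T"
  shows "b_open s p q (enriched T s p q n)"
  unfolding b_open_def
proof (intro conjI ballI)
  show "enriched T s p q n \<subseteq> bspace s p q" by (auto simp: enriched_def)
next
  fix c assume c: "c \<in> enriched T s p q n"
  let ?dp = "d_over_p TYPE('d) p"
  obtain J where J: "n \<le> J" "enriched_at T s ?dp n J c"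
    using c by (auto simp: enriched_def)
  \<comment> \<open>The slack of each strict inequality, in the weight with which the norm controls
    that coefficient.\<close>
  define gap where "gap = (\<lambda>(i, j, k). (cmod (c i j k) - enrichment_level s ?dp n J j) * 2 powr ((s - ?dp) * real j))"
  \<comment> \<open>The inserted 1 gives the minimum a nonempty set even if there are no
    indices.\<close>
  let ?G = "insert 1 (gap ` enriched_indices T n J)"
  define \<epsilon> where "\<epsilon> = Min ?G"
  have fin: "finite ?G" using finite_enriched_indices[OF T] by blast
  have "\<forall>g\<in>?G. 0 < g"
    using J(2) by (auto simp: enriched_at_def gap_def)
  then have \<epsilon>: "0 < \<epsilon>"
    unfolding \<epsilon>_def using Min_in[OF fin] by blast
  have "c' \<in> enriched T s p q n" if c': "c' \<in> bspace s p q" and near: "bnorm s p q (c' - c) < ennreal \<epsilon>" for c'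
  proof -
    have "enrichment_level s ?dp n J j < cmod (c' i j k)" if mem: "(i, j, k) \<in> enriched_indices T n J" for i j k
    proof -
      have "ennreal (cmod ((c' - c) i j k) * 2 powr ((s - ?dp) * real j)) \<le> bnorm s p q (c' - c)"
        using coefficient_le_layer[OF p] layer_le_bnorm[OF q] by (rule order_trans)
      also note near
      finally have "cmod (c' i j k - c i j k) * 2 powr ((s - ?dp) * real j) < \<epsilon>"
        by (simp add: ennreal_less_iff)
      also have "\<epsilon> \<le> gap (i, j, k)"
        unfolding \<epsilon>_def using fin mem by (intro Min_le) auto
      finally have "cmod (c' i j k - c i j k) < cmod (c i j k) - enrichment_level s ?dp n J j"
        by (simp add: gap_def)
      then show ?thesis
        using norm_triangle_ineq2[of "c i j k" "c' i j k"] by (simp add: norm_minus_commute)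
    qed
    then show ?thesis using c' J(1) by (auto simp: enriched_def enriched_at_def)
  qed
  then show "\<exists>\<epsilon>>0. \<forall>c'\<in>bspace s p q. bnorm s p q (c' - c) < ennreal \<epsilon> \<longrightarrow> c' \<in> enriched T s p q n"
    using \<epsilon> by blast
qed

lemma b_dense_enriched:
  fixes T :: "('i \<times> nat \<times> (int^'d::finite)) set"
  assumes p: "0 < p" and q: "0 < q" and T: "finite T" and n: "1 \<le> n"
  shows "b_dense s p q (enriched T s p q n)"
  unfolding b_dense_def
proof (intro conjI ballI allI impI)
  show "enriched T s p q n \<subseteq> bspace s p q" by (auto simp: enriched_def)
next
  fix c :: "'i \<Rightarrow> nat \<Rightarrow> int^'d \<Rightarrow> complex" and \<epsilon> :: real
  assume c: "c \<in> bspace s p q" and \<epsilon>: "0 < \<epsilon>"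
  define dp where "dp = d_over_p TYPE('d) p"
  \<comment> \<open>The square root of 2^(-1/n): of the decay 2^(-j/n) = \<rho>^j \<rho>^j, one
    factor is summed over the scales and the other, at most \<rho>^J, makes the perturbation
    small.\<close>
  define \<rho> :: real where "\<rho> = 2 powr (- (1 / (2 * real n)))"
  have \<rho>: "0 < \<rho>" "\<rho> < 1" using n by (auto simp: \<rho>_def powr_minus field_simps)
  have \<rho>_pow: "\<rho> ^ j = 2 powr (- (real j / (2 * real n)))" for j
    by (simp add: \<rho>_def powr_power)
  obtain B where B: "0 < B" "\<And>(e :: 'i \<Rightarrow> nat \<Rightarrow> int^'d \<Rightarrow> complex) A. 0 \<le> A \<Longrightarrow>
      (\<forall>j. layer s p e j \<le> ennreal (A * \<rho> ^ j)) \<Longrightarrow> bnorm s p q e \<le> ennreal (A * B)"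
    using bnorm_geometric_bound[OF q \<rho>, where ?'i = 'i and ?'d = 'd, of s p] by blast
  \<comment> \<open>The p-th root of the number of indices at one scale, with the factor 2^(dp J)
    taken out; it is free of \<open>J\<close>.\<close>
  define h where "h = (real (card T + 1) * (3 * real n) ^ CARD('d)) powr (dp / real CARD('d))"
  have h: "0 \<le> h" by (simp add: h_def)
  have "(\<lambda>J. 3 * h * B * \<rho> ^ J) \<longlonglongrightarrow> 3 * h * B * 0"
    using \<rho> by (intro tendsto_intros LIMSEQ_realpow_zero) auto
  then have "\<forall>\<^sub>F J in sequentially. 3 * h * B * \<rho> ^ J < \<epsilon>"
    using \<epsilon> by (intro order_tendstoD) auto
  then have "\<forall>\<^sub>F J in sequentially. 3 * h * B * \<rho> ^ J < \<epsilon> \<and> n \<le> J"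
    by (intro eventually_conj eventually_ge_at_top)
  then obtain J where J: "3 * h * B * \<rho> ^ J < \<epsilon>" "n \<le> J"
    unfolding eventually_sequentially by blast
  define E where "E = enriched_indices T n J"
  define lv where "lv = enrichment_level s dp n J"
  have lv: "0 < lv j" for j by (simp add: lv_def enrichment_level_def)
  define c' where "c' i j k = (if (i, j, k) \<in> E \<and> cmod (c i j k) \<le> lv j then of_real (2 * lv j) else c i j k)" for i j k
  have diff_le: "cmod ((c' - c) i j k) \<le> 3 * lv j" for i j k
  proof -
    have "cmod (of_real (2 * lv j) - c i j k) \<le> 2 * lv j + cmod (c i j k)"
      using norm_triangle_ineq4[of "of_real (2 * lv j) :: complex" "c i j k"] lv[of j] by simp
    then show ?thesis using lv[of j] by (auto simp: c'_def)
  qed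
  have diff_0: "(c' - c) i j k = 0" if "(i, j, k) \<notin> E" for i j k
    using that by (simp add: c'_def)
  have lay: "layer s p (c' - c) j \<le> ennreal (3 * h * \<rho> ^ J * \<rho> ^ j)" for j
  proof (cases "J \<le> j")
    case False
    then have "(i, j, k) \<notin> E" for i k
      using enriched_indices_scale[of i j k T n J] unfolding E_def by auto
    then have zero: "(c' - c) i j k = 0" for i k by (rule diff_0)
    have "layer s p (c' - c) j \<le> ennreal (1 powr (d_over_p TYPE('d) p / real CARD('d)) * 0)"
      by (rule layer_finite_support_le[OF p, where S = "{}"]) (use zero in simp_all)
    then show ?thesis by simp
  next
    case True
    define N where "N = real (card T + 1) * (3 * real n * 2 ^ J) ^ CARD('d)"
    note S = enriched_indices_layer[OF T n, of j J, folded E_def N_def]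
    have "1 \<le> 3 * real n * 2 ^ J"
      using mult_mono[of 1 "3 * real n" 1 "2 ^ J"] n by simp
    then have N: "1 \<le> N"
      unfolding N_def using mult_mono[of 1 "real (card T + 1)" 1 "(3 * real n * 2 ^ J) ^ CARD('d)"]
      by (simp add: one_le_power)
    define a where "a = 3 * 2 powr (- (real j / real n) - dp * real J)"
    have a: "cmod ((c' - c) i j k) * 2 powr ((s - d_over_p TYPE('d) p) * real j) \<le> a" for i k
    proof -
      have "cmod ((c' - c) i j k) * 2 powr ((s - dp) * real j) \<le> 3 * lv j * 2 powr ((s - dp) * real j)"
        by (intro mult_right_mono diff_le) auto
      also have "\<dots> = a"
      proof -
        have "(dp - s - 1 / real n) * real j - dp * real J + (s - dp) * real j = - (real j / real n) - dp * real J"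
          by (simp add: algebra_simps)
        then show ?thesis
          by (simp only: a_def lv_def enrichment_level_def mult.assoc powr_add[symmetric])
      qed
      finally show ?thesis unfolding dp_def .
    qed
    have "layer s p (c' - c) j \<le> ennreal (N powr (d_over_p TYPE('d) p / real CARD('d)) * a)"
    proof (rule layer_finite_support_le[OF p, where S = "{(i, k). (i, j, k) \<in> E}"])
      show "(c' - c) i j k = 0" if "(i, k) \<notin> {(i, k). (i, j, k) \<in> E}" for i k
        using that by (intro diff_0) auto
    qed (use S N a in auto)
    also have "N powr (d_over_p TYPE('d) p / real CARD('d)) = h * 2 powr (dp * real J)"
    proof -
      have "N = (real (card T + 1) * (3 * real n) ^ CARD('d)) * 2 powr (real J * real CARD('d))"
        by (simp add: N_def power_mult_distrib powr_realpow flip: power_mult of_nat_mult)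
      then have "N powr (dp / real CARD('d)) = h * (2 powr (real J * real CARD('d))) powr (dp / real CARD('d))"
        by (simp add: h_def powr_mult)
      then show ?thesis by (simp add: powr_powr dp_def mult.commute)
    qed
    also have "h * 2 powr (dp * real J) * a = 3 * h * 2 powr (- (real j / real n))"
      by (simp add: a_def powr_diff powr_minus)
    also have "\<dots> = 3 * h * (\<rho> ^ j * \<rho> ^ j)"
      by (simp add: \<rho>_pow flip: powr_add)
    also have "\<dots> \<le> 3 * h * (\<rho> ^ J * \<rho> ^ j)"
      using h \<rho> True by (intro mult_left_mono mult_right_mono power_decreasing) auto
    finally show ?thesis by (simp only: mult.assoc ennreal_leI)
  qed
  have "bnorm s p q (c' - c) \<le> ennreal (3 * h * \<rho> ^ J * B)"
    using h \<rho> lay by (intro B) auto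
  also have "\<dots> < ennreal \<epsilon>"
    using J(1) \<epsilon> by (intro ennreal_lessI) (auto simp: mult_ac)
  finally have near: "bnorm s p q (c' - c) < ennreal \<epsilon>" .
  then have "c' - c \<in> bspace s p q"
    unfolding bspace_def by (auto intro: less_trans)
  then have "c' \<in> bspace s p q"
    by (rule bspace_perturb[OF p q c])
  moreover have "enriched_at T s dp n J c'"
    unfolding enriched_at_def lv_def[symmetric] E_def[symmetric]
  proof safe
    fix i j k assume "(i, j, k) \<in> E"
    then show "lv j < cmod (c' i j k)" using lv[of j] by (auto simp: c'_def)
  qed
  ultimately have "c' \<in> enriched T s p q n"
    using J(2) unfolding enriched_def dp_def by blast
  then show "\<exists>c'\<in>enriched T s p q n. bnorm s p q (c' - c) < ennreal \<epsilon>"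
    using near by blast
qed

text \<open>The covering property is applied to the fractional parts of 2^j x, and the resulting
  wavelet is rescaled to the cube of scale j that contains x.\<close>

lemma wav_covering:
  fixes \<psi> :: "'i \<Rightarrow> real^'d::finite \<Rightarrow> complex"
  assumes cov: "\<And>x. \<forall>m. 0 \<le> x $ m \<and> x $ m < 1 \<Longrightarrow> \<exists>(i, l, k)\<in>T. C0 \<le> cmod (wav \<psi> i l k x)"
  shows "\<exists>(i, l, k)\<in>T. C0 \<le> cmod (wav \<psi> i (j + l) (covering_index k l (\<chi> m. \<lfloor>2 ^ j * x $ m\<rfloor>)) x)"
proof -
  define y :: "real^'d" where "y = (\<chi> m. 2 ^ j * x $ m - \<lfloor>2 ^ j * x $ m\<rfloor>)"
  have "0 \<le> y $ m \<and> y $ m < 1" for m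
    unfolding y_def by (simp, linarith)
  then obtain i l k where T: "(i, l, k) \<in> T" and le: "C0 \<le> cmod (wav \<psi> i l k y)"
    using cov[of y] by auto
  have "2 ^ l *\<^sub>R y - (\<chi> m. real_of_int (k $ m)) =
      2 ^ (j + l) *\<^sub>R x - (\<chi> m. real_of_int (covering_index k l (\<chi> m. \<lfloor>2 ^ j * x $ m\<rfloor>) $ m))"
    by (simp add: vec_eq_iff y_def covering_index_def power_add algebra_simps)
  then have "wav \<psi> i l k y = wav \<psi> i (j + l) (covering_index k l (\<chi> m. \<lfloor>2 ^ j * x $ m\<rfloor>)) x"
    by (simp add: wav_def)
  then show ?thesis using T le by auto
qed

text \<open>The floor condition says that the cube of scale j around x has a lower corner in 2^-J
  Z^d, so one of the enriched wavelets is large at x itself. Its level 2^((dp-s-1/n)j - dp J) is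
  evaluated with J at most (\<beta> + 1/n) j.\<close>

lemma div_exp_ge_of_enriched:
  fixes \<psi> :: "'i \<Rightarrow> real^'d::finite \<Rightarrow> complex" and J :: "nat \<Rightarrow> nat"
  assumes C0: "0 < C0"
    and cov: "\<And>x. \<forall>m. 0 \<le> x $ m \<and> x $ m < 1 \<Longrightarrow> \<exists>(i, l, k)\<in>T. C0 \<le> cmod (wav \<psi> i l k x)"
    and J: "\<And>n. 1 \<le> n \<Longrightarrow> n \<le> J n" "\<And>n. 1 \<le> n \<Longrightarrow> enriched_at T s dp n (J n) c"
    and dp: "0 \<le> dp" and \<beta>: "0 \<le> \<beta>"
    and x: "\<And>n0. \<exists>n\<ge>n0. \<exists>j\<in>{J n..n * J n + 1}. real (J n) \<le> (\<beta> + 1 / real n) * real j \<and>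
      (\<forall>m. \<lfloor>2 ^ j * x $ m\<rfloor> = 2 ^ (j - J n) * \<lfloor>2 ^ J n * x $ m\<rfloor>)"
  shows "ereal (- s + dp * (1 - \<beta>)) \<le> div_exp \<psi> c x"
proof -
  define \<gamma> where "\<gamma> = - s + dp * (1 - \<beta>)"
  have below: "ereal g \<le> div_exp \<psi> c x" if g: "g < \<gamma>" for g
  proof (rule div_exp_geI[OF C0])
    fix j0
    \<comment> \<open>The exponent reached at n is at least \<gamma> - (1 + dp)/n: 1/n is lost in
      the level and dp/n in the approximation of \<beta>.\<close>
    obtain n1 :: nat where n1: "(1 + dp) / (\<gamma> - g) \<le> real n1" using real_arch_simple by blast
    obtain n2 :: nat where n2: "norm x \<le> real n2" using real_arch_simple by blast
    obtain n j where n: "max (max j0 1) (max n1 n2) \<le> n" and j: "J n \<le> j" "j \<le> n * J n + 1"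
      "real (J n) \<le> (\<beta> + 1 / real n) * real j"
      and fl: "\<And>m. \<lfloor>2 ^ j * x $ m\<rfloor> = 2 ^ (j - J n) * \<lfloor>2 ^ J n * x $ m\<rfloor>"
      using x[of "max (max j0 1) (max n1 n2)"] by auto
    have n_pos: "1 \<le> n" and nj0: "j0 \<le> n" using n by auto
    define K :: "int^'d" where "K = (\<chi> m. \<lfloor>2 ^ J n * x $ m\<rfloor>)"
    have K: "K \<in> dyadic_box n (J n)"
    proof -
      have "K $ m \<in> {- (int n * 2 ^ J n)..int n * 2 ^ J n}" for m
      proof -
        have "\<bar>x $ m\<bar> \<le> real n" using component_le_norm_cart[of x m] n2 n by simp
        then have "x $ m \<le> real n" "- real n \<le> x $ m" by linarith+
        then have "2 ^ J n * x $ m \<le> 2 ^ J n * real n" "2 ^ J n * - real n \<le> 2 ^ J n * x $ m"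
          by (intro mult_left_mono; simp)+
        then have "2 ^ J n * x $ m \<le> of_int (int n * 2 ^ J n)" "of_int (- (int n * 2 ^ J n)) \<le> 2 ^ J n * x $ m"
          by (simp_all only: of_int_mult of_int_of_nat_eq of_int_minus of_int_power of_int_numeral
              mult.commute mult_minus_left mult_minus_right)
        then have "\<lfloor>2 ^ J n * x $ m\<rfloor> \<le> int n * 2 ^ J n" "- (int n * 2 ^ J n) \<le> \<lfloor>2 ^ J n * x $ m\<rfloor>"
          using floor_mono[of "2 ^ J n * x $ m" "of_int (int n * 2 ^ J n)"]
          unfolding floor_of_int le_floor_iff by blast+
        then show ?thesis by (simp add: K_def)
      qed
      then show ?thesis unfolding dyadic_box_def by blast
    qed
    have "(\<chi> m. \<lfloor>2 ^ j * x $ m\<rfloor>) = (\<chi> m. 2 ^ (j - J n) * K $ m)"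
      by (simp add: vec_eq_iff K_def fl)
    then obtain i l k where T: "(i, l, k) \<in> T"
      and le: "C0 \<le> cmod (wav \<psi> i (j + l) (covering_index k l (\<chi> m. 2 ^ (j - J n) * K $ m)) x)"
      using wav_covering[OF cov, of j x] by auto
    let ?k = "covering_index k l (\<chi> m. 2 ^ (j - J n) * K $ m)"
    have "(i, j + l, ?k) \<in> enriched_indices T n (J n)"
      unfolding enriched_indices_def using T K j
      by (intro image_eqI[of _ _ "((i, l, k), j, K)"]) auto
    then have big: "enrichment_level s dp n (J n) (j + l) < cmod (c i (j + l) ?k)"
      using J(2)[OF n_pos] unfolding enriched_at_def by blast
    have "g * real (j + l) \<le> (dp - s - 1 / real n) * real (j + l) - dp * real (J n)"
    proof -
      have "(1 + dp) / (\<gamma> - g) \<le> real n" using n1 n by simp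
      then have "(1 + dp) / real n \<le> \<gamma> - g"
        using g n_pos by (simp add: divide_le_eq mult.commute)
      then have "((1 + dp) / real n) * real (j + l) \<le> (\<gamma> - g) * real (j + l)"
        by (intro mult_right_mono) auto
      moreover have "real (J n) \<le> (\<beta> + 1 / real n) * real (j + l)"
        by (rule order_trans[OF j(3) mult_left_mono]) (use \<beta> in auto)
      then have "dp * real (J n) \<le> dp * ((\<beta> + 1 / real n) * real (j + l))"
        using dp by (intro mult_left_mono)
      ultimately show ?thesis by (simp add: \<gamma>_def algebra_simps add_divide_distrib)
    qed
    then have "2 powr (g * real (j + l)) \<le> enrichment_level s dp n (J n) (j + l)"
      unfolding enrichment_level_def by (rule powr_mono) simp
    also note less_imp_le[OF big]
    finally have "2 powr (g * real (j + l)) \<le> cmod (c i (j + l) ?k)" .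
    then have "2 powr (g * real (j + l)) * C0 \<le> cmod (c i (j + l) ?k) * cmod (wav \<psi> i (j + l) ?k x)"
      using le C0 by (intro mult_mono) auto
    then have "C0 * 2 powr (g * real (j + l)) \<le> cmod (c i (j + l) ?k * wav \<psi> i (j + l) ?k x)"
      by (simp only: norm_mult mult.commute)
    moreover have "j0 \<le> j + l" using nj0 J(1)[OF n_pos] j(1) by simp
    ultimately show "\<exists>j\<ge>j0. \<exists>i k. C0 * 2 powr (g * real j) \<le> cmod (c i j k * wav \<psi> i j k x)"
      by blast
  qed
  have "ereal \<gamma> \<le> div_exp \<psi> c x"
  proof (rule dense_le)
    fix z assume "z < ereal \<gamma>"
    then show "z \<le> div_exp \<psi> c x" using below by (cases z) auto
  qed
  then show ?thesis unfolding \<gamma>_def .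
qed

section \<open>Spreading binary digits\<close>

definition free_count :: "nat set \<Rightarrow> nat \<Rightarrow> nat" where
  "free_count Z m = card ({1..m} - Z)"

lemma free_count_0 [simp]: "free_count Z 0 = 0"
  by (simp add: free_count_def)

lemma free_count_Suc: "free_count Z (Suc m) = free_count Z m + (if Suc m \<in> Z then 0 else 1)"
proof -
  have "{1..Suc m} - Z = (if Suc m \<in> Z then {1..m} - Z else insert (Suc m) ({1..m} - Z))"
    by (auto simp: le_Suc_eq)
  then show ?thesis by (simp add: free_count_def)
qed

lemma free_count_ge_interval:
  assumes "{a<..b} \<inter> Z = {}" "b \<le> m"
  shows "b - a \<le> free_count Z m"
proof -
  have "card {a<..b} \<le> card ({1..m} - Z)"
    using assms by (intro card_mono) auto
  then show ?thesis by (simp add: free_count_def)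
qed

text \<open>Off \<open>Z\<close> the count grows by 1 >= b at each step, so its lead over b m can
  only shrink at positions in \<open>Z\<close>, and it suffices to check the bound there. The
  constant absorbs the initial segment.\<close>

lemma free_count_linear_lower_bound:
  fixes b C :: real
  assumes b: "0 \<le> b" "b \<le> 1" and C: "0 \<le> C"
    and Z: "\<And>m. m \<in> Z \<Longrightarrow> M < m \<Longrightarrow> b * real m - C \<le> real (free_count Z m)"
  shows "b * real m - (C + real M) \<le> real (free_count Z m)"
proof (induction m)
  case 0
  then show ?case using C by simp
next
  case (Suc m)
  show ?case
  proof (cases "Suc m \<le> M")
    case True
    have "b * real (Suc m) \<le> 1 * real M" using b True by (intro mult_mono) auto
    then show ?thesis using C by linarith
  next
    case False
    show ?thesis
    proof (cases "Suc m \<in> Z")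
      case True
      then show ?thesis using Z[of "Suc m"] False by simp
    next
      case False
      then show ?thesis using Suc.IH b by (simp add: free_count_Suc algebra_simps)
    qed
  qed
qed

text \<open>The nested intervals [a m, a m + 1] / 2^m have a common point. Infinitely many digits 0
  keep it away from the right endpoints, that is, they exclude expansions ending in ones
  only.\<close>

lemma exists_real_with_dyadic_floors:
  fixes a :: "nat \<Rightarrow> int"
  assumes digit: "\<And>m. a (Suc m) - 2 * a m \<in> {0, 1}"
    and zero: "\<And>n. \<exists>m\<ge>n. a (Suc m) = 2 * a m"
  shows "\<exists>x::real. \<forall>m. \<lfloor>2 ^ m * x\<rfloor> = a m"
proof -
  define l :: "nat \<Rightarrow> real" where "l m = a m / 2 ^ m" for m
  define u :: "nat \<Rightarrow> real" where "u m = (a m + 1) / 2 ^ m" for m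
  have real_digit: "real_of_int (a (Suc m)) = 2 * a m \<or> real_of_int (a (Suc m)) = 2 * a m + 1" for m
  proof -
    have "a (Suc m) = 2 * a m \<or> a (Suc m) = 2 * a m + 1" using digit[of m] by auto
    then show ?thesis by auto
  qed
  have "l m \<le> l (Suc m)" for m
    using real_digit[of m] by (auto simp: l_def field_simps)
  then have l: "incseq l" by (rule incseq_SucI)
  have "u (Suc m) \<le> u m" for m
    using real_digit[of m] by (auto simp: u_def field_simps)
  then have u: "decseq u" by (rule decseq_SucI)
  have lu: "l k \<le> u m" for k m
  proof -
    have "l k \<le> l (max k m)" using l by (simp add: incseq_def)
    also have "\<dots> \<le> u (max k m)" by (simp add: l_def u_def divide_right_mono)
    also have "\<dots> \<le> u m" using u by (simp add: decseq_def)
    finally show ?thesis .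
  qed
  define x where "x = (SUP k. l k)"
  have "bdd_above (range l)" using lu by (intro bdd_aboveI[of _ "u 0"]) auto
  then have lx: "l m \<le> x" for m unfolding x_def by (intro cSUP_upper) auto
  have xu: "x \<le> u m" for m unfolding x_def by (intro cSUP_least lu) auto
  have "x < u m" for m
  proof -
    obtain n where n: "m \<le> n" "a (Suc n) = 2 * a n" using zero by blast
    have "x \<le> u (Suc n)" by (rule xu)
    also have "\<dots> < u n" using n(2) by (simp add: u_def field_simps)
    also have "\<dots> \<le> u m" using u n(1) by (simp add: decseq_def)
    finally show ?thesis .
  qed
  with lx have "\<lfloor>2 ^ m * x\<rfloor> = a m" for m
    by (intro floor_unique) (auto simp: l_def u_def pos_divide_le_eq pos_less_divide_eq mult.commute)
  then show ?thesis by blast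
qed

text \<open>\<open>spread Z y m\<close> is \<open>\<lfloor>2\<^sup>m x\<rfloor>\<close> for the number \<open>x\<close> whose binary digits are \<open>0\<close> at the positions
  in \<open>Z\<close>, and which carries the digits of \<open>y\<close>, in order, at the other positions.\<close>

primrec spread :: "nat set \<Rightarrow> real \<Rightarrow> nat \<Rightarrow> int" where
  "spread Z y 0 = \<lfloor>y\<rfloor>"
| "spread Z y (Suc m) = 2 * spread Z y m +
    (if Suc m \<in> Z then 0 else \<lfloor>2 ^ Suc (free_count Z m) * y\<rfloor> - 2 * \<lfloor>2 ^ free_count Z m * y\<rfloor>)"

lemma floor_double_digit: "\<lfloor>2 * x\<rfloor> - 2 * \<lfloor>x\<rfloor> \<in> {0, 1}" for x :: real
  by (simp, linarith)

lemma spread_digit: "spread Z y (Suc m) - 2 * spread Z y m \<in> {0, 1}"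
  using floor_double_digit[of "2 ^ free_count Z m * y"] by (auto simp: mult.assoc)

text \<open>Digits are 0 or 1, so the value at \<open>Suc m\<close> determines the one at
  \<open>m\<close> and hence all earlier digits, among them those copied from y. This is what
  confines the preimage of a cube to one cube of scale \<open>free_count Z m\<close>.\<close>

lemma spread_eq_imp_floor_eq:
  "spread Z y m = spread Z y' m \<Longrightarrow> \<lfloor>2 ^ free_count Z m * y\<rfloor> = \<lfloor>2 ^ free_count Z m * y'\<rfloor>"
proof (induction m)
  case (Suc m)
  have eq: "spread Z y m = spread Z y' m"
    using Suc.prems spread_digit[of Z y m] spread_digit[of Z y' m] by auto
  show ?case
    using Suc.IH[OF eq] Suc.prems eq by (auto simp: free_count_Suc split: if_splits)
qed simp

lemma spread_zero_block:
  assumes "{J<..j} \<subseteq> Z" "J \<le> j"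
  shows "spread Z y j = 2 ^ (j - J) * spread Z y J"
  using assms(2,1)
proof (induction j rule: dec_induct)
  case (step n)
  then have "spread Z y (Suc n) = 2 * (2 ^ (n - J) * spread Z y J)"
    by (simp add: greaterThanAtMost_iff subset_iff)
  then show ?case using step by (simp add: Suc_diff_le)
qed simp

lemma spread_before_zeros:
  assumes "{1..M} \<inter> Z = {}" "m \<le> M"
  shows "free_count Z m = m" "spread Z y m = \<lfloor>2 ^ m * y\<rfloor>"
proof -
  have "free_count Z m = m \<and> spread Z y m = \<lfloor>2 ^ m * y\<rfloor>"
    using assms(2)
  proof (induction m)
    case (Suc m)
    then have "Suc m \<in> {1..M}" by simp
    then have "Suc m \<notin> Z" using assms(1) by blast
    then show ?case using Suc by (simp add: free_count_Suc)
  qed simp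
  then show "free_count Z m = m" "spread Z y m = \<lfloor>2 ^ m * y\<rfloor>" by auto
qed

text \<open>The hypothesis makes every spread digit sequence an admissible expansion. The
  conclusions provide, in order, the mass bound, the dyadic approximation, and localisation in a
  given open set.\<close>

lemma exists_digit_spreading_map:
  assumes Z: "\<And>n. \<exists>m\<ge>n. Suc m \<in> Z"
  shows "\<exists>f :: real^'d::finite \<Rightarrow> real^'d.
    (\<forall>m K. \<exists>L. f -` dyadic_cube m K \<subseteq> dyadic_cube (free_count Z m) L) \<and>
    (\<forall>J j y i. {J<..j} \<subseteq> Z \<longrightarrow> J \<le> j \<longrightarrow> \<lfloor>2 ^ j * f y $ i\<rfloor> = 2 ^ (j - J) * \<lfloor>2 ^ J * f y $ i\<rfloor>) \<and>
    (\<forall>M y i. {1..M} \<inter> Z = {} \<longrightarrow> \<bar>f y $ i - y $ i\<bar> \<le> 1 / 2 ^ M)"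
proof -
  have "\<exists>x::real. \<forall>m. \<lfloor>2 ^ m * x\<rfloor> = spread Z y m" for y
  proof (intro exists_real_with_dyadic_floors spread_digit)
    fix n
    obtain m where "m \<ge> n" "Suc m \<in> Z" using Z by blast
    then show "\<exists>m\<ge>n. spread Z y (Suc m) = 2 * spread Z y m" by auto
  qed
  then obtain g :: "real \<Rightarrow> real" where g: "\<And>y m. \<lfloor>2 ^ m * g y\<rfloor> = spread Z y m"
    by metis
  define f where "f y = (\<chi> i. g (y $ i))" for y :: "real^'d"
  show ?thesis
  proof (intro exI[of _ f] conjI allI impI)
    fix m and K :: "int^'d"
    show "\<exists>L. f -` dyadic_cube m K \<subseteq> dyadic_cube (free_count Z m) L"
    proof (cases "f -` dyadic_cube m K = {}")
      case False
      then obtain y where y: "f y \<in> dyadic_cube m K" by auto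
      have "f -` dyadic_cube m K \<subseteq> dyadic_cube (free_count Z m) (\<chi> i. \<lfloor>2 ^ free_count Z m * y $ i\<rfloor>)"
      proof
        fix y' assume "y' \<in> f -` dyadic_cube m K"
        with y have "spread Z (y' $ i) m = spread Z (y $ i) m" for i
          by (simp add: dyadic_cube_def f_def g)
        then show "y' \<in> dyadic_cube (free_count Z m) (\<chi> i. \<lfloor>2 ^ free_count Z m * y $ i\<rfloor>)"
          by (auto simp: dyadic_cube_def dest: spread_eq_imp_floor_eq)
      qed
      then show ?thesis by blast
    qed auto
  next
    fix J j y i
    assume "{J<..j} \<subseteq> Z" "J \<le> j"
    then show "\<lfloor>2 ^ j * f y $ i\<rfloor> = 2 ^ (j - J) * \<lfloor>2 ^ J * f y $ i\<rfloor>"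
      by (simp add: f_def g spread_zero_block)
  next
    fix M y i
    assume "{1..M} \<inter> Z = {}"
    then have "\<lfloor>2 ^ M * f y $ i\<rfloor> = \<lfloor>2 ^ M * y $ i\<rfloor>"
      by (simp add: f_def g spread_before_zeros)
    then have "\<bar>2 ^ M * f y $ i - 2 ^ M * y $ i\<bar> \<le> 1"
      by linarith
    then have "2 ^ M * \<bar>f y $ i - y $ i\<bar> \<le> 1"
      by (simp add: abs_mult flip: right_diff_distrib)
    then show "\<bar>f y $ i - y $ i\<bar> \<le> 1 / 2 ^ M"
      by (simp add: field_simps)
  qed
qed

text \<open>Zeroing the binary digits at the positions in \<open>(J n, j n]\<close> with \<open>J n / j n \<approx> \<beta>\<close>, along a very sparse
  subsequence of \<open>n\<close>, leaves about \<open>\<beta> m\<close> free digits among the first \<open>m\<close>.\<close>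

lemma exists_dyadic_approximation_map:
  fixes J :: "nat \<Rightarrow> nat" and \<beta> :: real
  assumes J: "\<And>n. 1 \<le> n \<Longrightarrow> n \<le> J n" and \<beta>: "0 \<le> \<beta>" "\<beta> \<le> 1"
  shows "\<exists>(f :: real^'d::finite \<Rightarrow> real^'d) r.
    (\<forall>m K. \<exists>L. f -` dyadic_cube m K \<subseteq> dyadic_cube (r m) L) \<and>
    (\<forall>y i. \<bar>f y $ i - y $ i\<bar> \<le> 1 / 2 ^ M) \<and>
    (\<forall>y n0. \<exists>n\<ge>n0. \<exists>j\<in>{J n..n * J n + 1}. real (J n) \<le> (\<beta> + 1 / real n) * real j \<and>
      (\<forall>m. \<lfloor>2 ^ j * f y $ m\<rfloor> = 2 ^ (j - J n) * \<lfloor>2 ^ J n * f y $ m\<rfloor>)) \<and>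
    (\<forall>t. 0 \<le> t \<longrightarrow> t < real CARD('d) * \<beta> \<longrightarrow>
      (\<exists>C>0. \<forall>m. (1 / 2 ^ r m) ^ CARD('d) \<le> C * 2 powr (- t * real m)))"
proof -
  \<comment> \<open>The truncation at 1/n keeps J n / bn n finite when \<beta> = 0, and at most n J
    n for every \<beta>.\<close>
  define bn where "bn n = max \<beta> (1 / real n)" for n
  \<comment> \<open>The extra 1 gives J n < j n even for \<beta> = 1, so no block of zeros is empty;
    it is the origin of the bound \<open>n * J + 1\<close> in
    \<open>enriched_indices\<close>.\<close>
  define j where "j n = nat \<lceil>real (J n) / bn n\<rceil> + 1" for n
  have j: "J n < j n" "j n \<le> n * J n + 1" "real (J n) \<le> (\<beta> + 1 / real n) * real (j n)"
    "\<beta> * (real (j n) - 2) \<le> real (J n)" if n: "1 \<le> n" for n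
  proof -
    have bn: "0 < bn n" "bn n \<le> 1" "1 / real n \<le> bn n" "\<beta> \<le> bn n" "bn n \<le> \<beta> + 1 / real n"
      using n \<beta> by (auto simp: bn_def less_max_iff_disj)
    define a where "a = real (J n) / bn n"
    have a: "bn n * a = real (J n)" "0 \<le> a" using bn by (auto simp: a_def)
    have ja: "real (j n) = real_of_int \<lceil>a\<rceil> + 1" using a by (simp add: j_def a_def)
    then have lo: "a + 1 \<le> real (j n)" and hi: "real (j n) \<le> a + 2" by linarith+
    have "real (J n) = bn n * a" using a by simp
    also have "\<dots> \<le> 1 * a" using bn a by (intro mult_right_mono) auto
    finally show "J n < j n" using lo by simp
    have "real (J n) / bn n \<le> real (J n) / (1 / real n)"
      using bn n by (intro divide_left_mono) auto
    then have "a \<le> real_of_int (int (n * J n))" by (simp add: a_def mult.commute)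
    then have "\<lceil>a\<rceil> \<le> int (n * J n)" by (rule ceiling_le)
    then have "real_of_int \<lceil>a\<rceil> \<le> real (n * J n)" by linarith
    then show "j n \<le> n * J n + 1" using ja by linarith
    have "real (J n) \<le> bn n * real (j n)"
      unfolding a(1)[symmetric] using bn lo by (intro mult_left_mono) auto
    also have "\<dots> \<le> (\<beta> + 1 / real n) * real (j n)" using bn by (intro mult_right_mono) auto
    finally show "real (J n) \<le> (\<beta> + 1 / real n) * real (j n)" .
    have "\<beta> * (real (j n) - 2) \<le> \<beta> * a" using hi \<beta> by (intro mult_left_mono) auto
    also have "\<dots> \<le> bn n * a" using bn a by (intro mult_right_mono) auto
    finally show "\<beta> * (real (j n) - 2) \<le> real (J n)" using a by simp
  qed
  \<comment> \<open>As J n >= n, the positions up to the end of one block are at most a fraction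
    1/(i+1) of those before the next. Starting at M + 1 leaves the first M digits alone.\<close>
  define N where "N = rec_nat (M + 1) (\<lambda>i n. Suc i * j n + n + 1)"
  have N_Suc: "N (Suc i) = Suc i * j (N i) + N i + 1" and N_0: "N 0 = M + 1" for i
    by (simp_all add: N_def)
  have N_ge: "M + 1 + i \<le> N i" for i
    by (induction i) (simp_all add: N_0 N_Suc)
  then have N1: "1 \<le> N i" for i using le_trans[OF _ N_ge[of i]] by simp
  define a where "a i = J (N i)" for i
  define b where "b i = j (N i)" for i
  have N_le_a: "N i \<le> a i" for i unfolding a_def by (rule J[OF N1])
  have ab: "a i < b i" for i unfolding a_def b_def by (rule j(1)[OF N1])
  have gap: "Suc i * b i \<le> a (Suc i)" for i
    using N_le_a[of "Suc i"] by (simp add: N_Suc b_def)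
  have ba: "b i \<le> a (Suc i)" for i
    using gap[of i] by simp
  have b_mono: "b i \<le> b k" if "i \<le> k" for i k
    by (rule lift_Suc_mono_le[OF _ that]) (use ba ab in \<open>meson less_imp_le order_trans\<close>)
  have a_mono: "a i \<le> a k" if "i \<le> k" for i k
    by (rule lift_Suc_mono_le[OF _ that]) (use ba ab in \<open>meson less_imp_le order_trans\<close>)
  define Z where "Z = (\<Union>i. {a i<..b i})"
  have Z_inf: "\<exists>m\<ge>n. Suc m \<in> Z" for n
  proof (intro exI[of _ "a n"] conjI)
    show "n \<le> a n" using N_ge[of n] N_le_a[of n] by simp
    show "Suc (a n) \<in> Z" unfolding Z_def using ab[of n] by auto
  qed
  obtain f :: "real^'d \<Rightarrow> real^'d" where f:
    "\<And>m K. \<exists>L. f -` dyadic_cube m K \<subseteq> dyadic_cube (free_count Z m) L"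
    "\<And>J j y i. {J<..j} \<subseteq> Z \<Longrightarrow> J \<le> j \<Longrightarrow> \<lfloor>2 ^ j * f y $ i\<rfloor> = 2 ^ (j - J) * \<lfloor>2 ^ J * f y $ i\<rfloor>"
    "\<And>M y i. {1..M} \<inter> Z = {} \<Longrightarrow> \<bar>f y $ i - y $ i\<bar> \<le> 1 / 2 ^ M"
    using exists_digit_spreading_map[OF Z_inf, where ?'d = 'd] by blast
  show ?thesis
  proof (intro exI[of _ f] exI[of _ "free_count Z"] conjI allI impI)
    show "\<exists>L. f -` dyadic_cube m K \<subseteq> dyadic_cube (free_count Z m) L" for m K by (rule f(1))
    have "M < m" if m: "m \<in> Z" for m
    proof -
      obtain i where "a i < m" using m by (auto simp: Z_def)
      then show ?thesis using N_ge[of i] N_le_a[of i] by simp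
    qed
    then have "{1..M} \<inter> Z = {}" by fastforce
    then show "\<bar>f y $ i - y $ i\<bar> \<le> 1 / 2 ^ M" for y i by (rule f(3))
  next
    fix y n0
    have "n0 \<le> N n0" using N_ge[of n0] by simp
    moreover have "j (N n0) \<in> {J (N n0)..N n0 * J (N n0) + 1}"
      using j(1,2)[OF N1[of n0]] by simp
    moreover have "{J (N n0)<..j (N n0)} \<subseteq> Z"
      unfolding Z_def a_def b_def by blast
    ultimately show "\<exists>n\<ge>n0. \<exists>j\<in>{J n..n * J n + 1}. real (J n) \<le> (\<beta> + 1 / real n) * real j \<and>
      (\<forall>m. \<lfloor>2 ^ j * f y $ m\<rfloor> = 2 ^ (j - J n) * \<lfloor>2 ^ J n * f y $ m\<rfloor>)"
      using j(3)[OF N1[of n0]] f(2)[of "J (N n0)" "j (N n0)" y]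
      by (intro exI[of _ "N n0"] conjI bexI[of _ "j (N n0)"]) auto
  next
    fix t assume t: "0 \<le> t" "t < real CARD('d) * \<beta>"
    define c where "c = t / real CARD('d)"
    have c: "0 \<le> c" "c < \<beta>" using t by (auto simp: c_def divide_less_eq mult.commute)
    \<comment> \<open>Beyond block \<open>I\<close>, all positions up to the end of the previous
      block make up at most a fraction \<beta> - c of m.\<close>
    obtain I :: nat where I: "1 / (\<beta> - c) \<le> real I" using real_arch_simple by blast
    \<comment> \<open>For m in block k, the positions between block k - 1 and block k are free. Up
      to the rounding in \<open>j\<close>, which causes the 2, block k starts no earlier than
      \<beta> m.\<close>
    have "c * real m - 2 \<le> real (free_count Z m)" if m: "m \<in> Z" "b I < m" for m
    proof -
      obtain k where k: "a k < m" "m \<le> b k" using m(1) by (auto simp: Z_def)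
      have "I < k" using b_mono[of k I] m(2) k(2) by (meson leD le_trans not_le)
      then obtain k' where k': "k = Suc k'" "I \<le> k'" by (cases k) auto
      have "{b k'<..a k} \<inter> Z = {}"
      proof -
        have "\<not> (b k' < x \<and> x \<le> a k \<and> a i < x \<and> x \<le> b i)" for x i
        proof (cases "i \<le> k'")
          case True
          then show ?thesis using b_mono[of i k'] by simp
        next
          case False
          then show ?thesis using a_mono[of k i] k'(1) by simp
        qed
        then show ?thesis by (auto simp: Z_def)
      qed
      then have "a k - b k' \<le> free_count Z m"
        using k(1) by (intro free_count_ge_interval) auto
      then have free: "real (a k) - real (b k') \<le> real (free_count Z m)" by linarith
      have "1 \<le> (\<beta> - c) * real (Suc k')"
      proof -
        have "1 = (\<beta> - c) * (1 / (\<beta> - c))" using c by simp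
        also have "\<dots> \<le> (\<beta> - c) * real (Suc k')" using c I k'(2) by (intro mult_left_mono) auto
        finally show ?thesis .
      qed
      then have "1 * real (b k') \<le> ((\<beta> - c) * real (Suc k')) * real (b k')"
        by (intro mult_right_mono) auto
      also have "\<dots> = (\<beta> - c) * real (Suc k' * b k')" by (simp only: of_nat_mult mult.assoc)
      also have "\<dots> \<le> (\<beta> - c) * real m"
      proof (intro mult_left_mono)
        have "Suc k' * b k' \<le> m" using gap[of k'] k(1) k'(1) by simp
        then show "real (Suc k' * b k') \<le> real m" by (simp only: of_nat_le_iff)
      qed (use c in auto)
      finally have "real (b k') \<le> (\<beta> - c) * real m" by simp
      moreover have "\<beta> * (real m - 2) \<le> real (a k)"
      proof -
        have "\<beta> * (real m - 2) \<le> \<beta> * (real (b k) - 2)" using k(2) \<beta> by (intro mult_left_mono) auto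
        also have "\<dots> \<le> real (a k)" unfolding a_def b_def by (rule j(4)[OF N1])
        finally show ?thesis .
      qed
      moreover have "\<beta> * 2 \<le> 2" using \<beta> by simp
      ultimately show ?thesis using free by (simp add: algebra_simps)
    qed
    then have lower: "c * real m - (2 + real (b I)) \<le> real (free_count Z m)" for m
      using c \<beta> by (intro free_count_linear_lower_bound) auto
    define C where "C = 2 powr (real CARD('d) * (2 + real (b I)))"
    have "(1 / 2 ^ free_count Z m) ^ CARD('d) \<le> C * 2 powr (- t * real m)" for m
    proof -
      have "(1 / 2 ^ free_count Z m) ^ CARD('d) = 2 powr (- (real CARD('d) * real (free_count Z m)))"
        by (simp add: powr_minus divide_inverse powr_realpow power_inverse mult.commute flip: power_mult of_nat_mult)
      also have "\<dots> \<le> 2 powr (- (real CARD('d) * (c * real m - (2 + real (b I)))))"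
        using mult_left_mono[OF lower, of "real CARD('d)"] by (intro powr_mono) auto
      also have "\<dots> = C * 2 powr (- t * real m)"
      proof -
        have "real CARD('d) * c = t" by (simp add: c_def)
        then have "- (real CARD('d) * (c * real m - (2 + real (b I)))) = real CARD('d) * (2 + real (b I)) + - t * real m"
          by (simp add: algebra_simps)
        then show ?thesis by (simp only: C_def powr_add)
      qed
      finally show ?thesis .
    qed
    then show "\<exists>C>0. \<forall>m. (1 / 2 ^ free_count Z m) ^ CARD('d) \<le> C * 2 powr (- t * real m)"
      by (intro exI[of _ C]) (auto simp: C_def)
  qed
qed

section \<open>Maximal divergence\<close>

lemma hausdorff_measure_mono:
  assumes "E \<subseteq> F"
  shows "hausdorff_measure t E \<le> hausdorff_measure t F"
proof -
  have "hausdorff_pre t \<delta> E \<le> hausdorff_pre t \<delta> F" for \<delta>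
    unfolding hausdorff_pre_def by (intro Inf_superset_mono) (use assms in blast)
  then show ?thesis
    unfolding hausdorff_measure_def by (intro SUP_mono) blast
qed

text \<open>At t = 0 every nonempty set costs 1, so a cover of cost below 1 consists of empty sets.
  This handles the one exponent that the mass distribution principle leaves out.\<close>

lemma hausdorff_measure_0_eq_0:
  assumes "hausdorff_measure 0 E = 0"
  shows "E = {}"
proof -
  have "hausdorff_pre 0 1 E \<le> hausdorff_measure 0 E"
    unfolding hausdorff_measure_def by (intro SUP_upper) auto
  then have "hausdorff_pre 0 1 E < 1"
    using assms by simp
  then obtain U :: "nat \<Rightarrow> 'a set" where U: "E \<subseteq> (\<Union>n. U n)" "(\<Sum>n. hausdorff_cost 0 (U n)) < 1"
    unfolding hausdorff_pre_def Inf_less_iff by blast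
  have "U n = {}" for n
  proof (rule ccontr)
    assume "U n \<noteq> {}"
    then have "1 = sum (\<lambda>n. hausdorff_cost 0 (U n)) {n}" by simp
    also have "\<dots> \<le> (\<Sum>n. hausdorff_cost 0 (U n))" by (intro sum_le_suminf) auto
    finally show False using U(2) by simp
  qed
  then show ?thesis using U(1) by simp
qed

lemma max_divergent_of_enriched:
  fixes \<psi> :: "'i::finite \<Rightarrow> real^'d::finite \<Rightarrow> complex" and J :: "nat \<Rightarrow> nat"
  assumes p: "0 < p" and q: "0 < q" and \<psi>: "bounded_fast_decaying \<psi>" and c: "c \<in> bspace s p q"
    and C0: "0 < C0"
    and cov: "\<And>x. \<forall>m. 0 \<le> x $ m \<and> x $ m < 1 \<Longrightarrow> \<exists>(i, l, k)\<in>T. C0 \<le> cmod (wav \<psi> i l k x)"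
    and J: "\<And>n. 1 \<le> n \<Longrightarrow> n \<le> J n"
      "\<And>n. 1 \<le> n \<Longrightarrow> enriched_at T s (d_over_p TYPE('d) p) n (J n) c"
  shows "max_divergent \<psi> s p c UNIV"
proof -
  define dp where "dp = d_over_p TYPE('d) p"
  have dp: "0 \<le> dp" unfolding dp_def by (rule d_over_p_nonneg[OF p])
  have lower: "ereal (- s + dp * (1 - \<beta>)) \<le> div_exp \<psi> c x"
    if "0 \<le> \<beta>" "\<And>n0. \<exists>n\<ge>n0. \<exists>j\<in>{J n..n * J n + 1}. real (J n) \<le> (\<beta> + 1 / real n) * real j \<and>
      (\<forall>m. \<lfloor>2 ^ j * x $ m\<rfloor> = 2 ^ (j - J n) * \<lfloor>2 ^ J n * x $ m\<rfloor>)" for \<beta> x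
    by (rule div_exp_ge_of_enriched[OF C0 cov J[folded dp_def] dp that])
  have ge: "ereal (- s) \<le> div_exp \<psi> c x" for x
  proof -
    \<comment> \<open>At \<beta> = 1 no zero digits are required: the choice j = J n works at every
      point.\<close>
    have "ereal (- s + dp * (1 - 1)) \<le> div_exp \<psi> c x"
    proof (rule lower[OF zero_le_one])
      fix n0 :: nat
      define n where "n = max n0 1"
      have "1 * J n \<le> n * J n" by (intro mult_le_mono1) (simp add: n_def)
      then have "J n \<in> {J n..n * J n + 1}" unfolding atLeastAtMost_iff by linarith
      moreover have "1 * real (J n) \<le> (1 + 1 / real n) * real (J n)"
        by (intro mult_right_mono) auto
      moreover have "n0 \<le> n" by (simp add: n_def)
      ultimately show "\<exists>n\<ge>n0. \<exists>j\<in>{J n..n * J n + 1}. real (J n) \<le> (1 + 1 / real n) * real j \<and>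
          (\<forall>m. \<lfloor>2 ^ j * x $ m\<rfloor> = 2 ^ (j - J n) * \<lfloor>2 ^ J n * x $ m\<rfloor>)"
        by (intro exI[of _ n] conjI bexI[of _ "J n"]) auto
    qed
    then show ?thesis by simp
  qed
  have le: "div_exp \<psi> c x \<le> ereal (dp - s)" for x
    unfolding dp_def by (rule div_exp_le[OF p q c \<psi>])
  show ?thesis
    using p
  proof (cases p rule: ereal_pos_cases)
    case infinite
    then have "dp = 0" by (simp add: dp_def d_over_p_def)
    then have "div_exp \<psi> c x = ereal (- s)" for x
      using ge[of x] le[of x] by (simp add: antisym)
    then show ?thesis
      using infinite by (simp add: max_divergent_def d_over_p_def)
  next
    case (finite r)
    define d where "d = real CARD('d)"
    have d: "0 < d" by (simp add: d_def)
    have dp_eq: "dp = d / r" using finite by (simp add: dp_def d_over_p_def d_def)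
    have null: "hausdorff_measure t {x. ereal \<gamma> < div_exp \<psi> c x} = 0"
      if "0 < t" "d - s * r - \<gamma> * r < t" for t \<gamma>
      using hausdorff_null_div_exp_gt[OF finite q c \<psi> that(1)] that(2) unfolding d_def by blast
    have negl: "negligible (f -` {x. div_exp \<psi> c x > ereal \<gamma>})"
      if D: "0 < d - s * r - \<gamma> * r"
        and cube: "\<And>m K. \<exists>L. f -` dyadic_cube m K \<subseteq> dyadic_cube (h m) L"
        and h: "\<And>t. 0 \<le> t \<Longrightarrow> t < d - s * r - \<gamma> * r \<Longrightarrow> \<exists>C>0. \<forall>m. (1 / 2 ^ h m) ^ CARD('d) \<le> C * 2 powr (- t * real m)"
      for f :: "real^'d \<Rightarrow> real^'d" and h \<gamma>
    proof -
      define D where "D = d - s * r - \<gamma> * r"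
      have "D > 0" using that(1) by (simp add: D_def)
      have "negligible (f -` {x. ereal (\<gamma> + 1 / real (Suc k)) < div_exp \<psi> c x})" for k
      proof -
        define u where "u = r / real (Suc k)"
        have "0 < u" using finite by (simp add: u_def)
        \<comment> \<open>An exponent strictly between the dimension bound D - u of the smaller set
          and \<open>D\<close>; the maximum with D/2 keeps it positive.\<close>
        define t where "t = max (D - u / 2) (D / 2)"
        have t: "0 < t" "t < D" "D - u < t"
          using \<open>0 < D\<close> \<open>0 < u\<close> by (auto simp: t_def less_max_iff_disj)
        obtain C where C: "0 < C" "\<And>m. (1 / 2 ^ h m) ^ CARD('d) \<le> C * 2 powr (- t * real m)"
          using h[of t] t unfolding D_def by auto
        have "d - s * r - (\<gamma> + 1 / real (Suc k)) * r < t"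
          using t(3) by (simp add: D_def u_def algebra_simps)
        then show ?thesis
          by (rule negligible_vimage_hausdorff_null[OF t(1) null[OF t(1)] cube C(2,1)])
      qed
      then have "negligible (\<Union>k. f -` {x. ereal (\<gamma> + 1 / real (Suc k)) < div_exp \<psi> c x})"
        by (intro negligible_countable_Union countable_image) auto
      moreover have "f -` {x. div_exp \<psi> c x > ereal \<gamma>} \<subseteq> (\<Union>k. f -` {x. ereal (\<gamma> + 1 / real (Suc k)) < div_exp \<psi> c x})"
      proof
        fix y assume "y \<in> f -` {x. div_exp \<psi> c x > ereal \<gamma>}"
        then have "ereal \<gamma> < div_exp \<psi> c (f y)" by simp
        then obtain g where "ereal \<gamma> < g" "g < div_exp \<psi> c (f y)" using dense by blast
        then obtain g' where g': "\<gamma> < g'" "ereal g' < div_exp \<psi> c (f y)" by (cases g) auto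
        obtain k where "1 / real (Suc k) < g' - \<gamma>"
          using nat_approx_posE[of "g' - \<gamma>"] g'(1) by auto
        then have "ereal (\<gamma> + 1 / real (Suc k)) < ereal g'" by simp
        also note g'(2)
        finally show "y \<in> (\<Union>k. f -` {x. ereal (\<gamma> + 1 / real (Suc k)) < div_exp \<psi> c x})" by blast
      qed
      ultimately show ?thesis by (rule negligible_subset)
    qed

    have ae: "AE x in lebesgue. div_exp \<psi> c x = ereal (- s)"
    proof -
      \<comment> \<open>At \<gamma> = -s the bound D is the full dimension d, and the identity map
        already has the required mass bound.\<close>
      have "negligible ((\<lambda>x. x) -` {x. div_exp \<psi> c x > ereal (- s)})"
      proof (rule negl)
        show "0 < d - s * r - - s * r" using d by simp
        show "\<exists>L. (\<lambda>x. x) -` dyadic_cube m K \<subseteq> dyadic_cube m L" for m and K :: "int^'d"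
          by (intro exI[of _ K]) auto
        fix t assume "0 \<le> t" "t < d - s * r - - s * r"
        then have t: "t \<le> d" by simp
        have "(1 / 2 ^ m) ^ CARD('d) \<le> 1 * 2 powr (- t * real m)" for m
        proof -
          have "(1 / 2 ^ m) ^ CARD('d) = 2 powr (- (d * real m))"
            by (simp add: d_def powr_minus divide_inverse powr_realpow power_inverse mult.commute
                flip: power_mult of_nat_mult)
          also have "\<dots> \<le> 2 powr (- t * real m)"
            using mult_right_mono[OF t, of "real m"] by (intro powr_mono) auto
          finally show ?thesis by simp
        qed
        then show "\<exists>C>0. \<forall>m. (1 / 2 ^ m) ^ CARD('d) \<le> C * 2 powr (- t * real m)"
          by (intro exI[of _ 1]) auto
      qed
      then have "{x. div_exp \<psi> c x > ereal (- s)} \<in> null_sets lebesgue"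
        by (simp add: negligible_iff_null_sets)
      moreover have "{x \<in> space lebesgue. div_exp \<psi> c x \<noteq> ereal (- s)} \<subseteq> {x. div_exp \<psi> c x > ereal (- s)}"
        using ge by (auto simp: less_le)
      ultimately show ?thesis by (intro AE_I')
    qed

    have dim: "dimH {x\<in>B. div_exp \<psi> c x = ereal \<gamma>} = ereal (d - s * r - \<gamma> * r)"
      if B: "open B" "B \<noteq> {}" and \<gamma>: "- s \<le> \<gamma>" "\<gamma> \<le> dp - s" for B \<gamma>
    proof -
      define F where "F = {x\<in>B. div_exp \<psi> c x = ereal \<gamma>}"
      define D where "D = d - s * r - \<gamma> * r"
      define \<beta> where "\<beta> = D / d"
      have D: "0 \<le> D" "D \<le> d"
      proof -
        have "(\<gamma> + s) * r \<le> dp * r" using \<gamma>(2) finite by (intro mult_right_mono) auto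
        then show "0 \<le> D" using finite by (simp add: D_def dp_eq algebra_simps)
        have "0 \<le> (\<gamma> + s) * r" using \<gamma>(1) finite by (intro mult_nonneg_nonneg) auto
        then show "D \<le> d" by (simp add: D_def algebra_simps)
      qed
      then have \<beta>: "0 \<le> \<beta>" "\<beta> \<le> 1" using d by (auto simp: \<beta>_def)
      have D_\<beta>: "D = real CARD('d) * \<beta>" using d by (simp add: \<beta>_def d_def)
      have \<gamma>_eq: "- s + dp * (1 - \<beta>) = \<gamma>"
        using d finite by (simp add: \<beta>_def dp_eq D_def field_simps)
      obtain x0 e where x0: "0 < e" "ball x0 e \<subseteq> B"
        using B by (metis ex_in_conv open_contains_ball)
      \<comment> \<open>\<open>f\<close> moves each coordinate by at most 2^-M, hence each point by
        less than e/2, so the concentric half ball is sent into B.\<close>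
      have "\<exists>M. (1 / 2) ^ M < e / 2 / d" using x0(1) d by (intro real_arch_pow_inv) auto
      then obtain M where "(1 / 2) ^ M < e / 2 / d" by blast
      then have M: "d * (1 / 2) ^ M < e / 2" using d by (simp add: pos_less_divide_eq mult_ac)
      obtain f :: "real^'d \<Rightarrow> real^'d" and h where f:
        "\<And>m K. \<exists>L. f -` dyadic_cube m K \<subseteq> dyadic_cube (h m) L"
        "\<And>y i. \<bar>f y $ i - y $ i\<bar> \<le> 1 / 2 ^ M"
        "\<And>y n0. \<exists>n\<ge>n0. \<exists>j\<in>{J n..n * J n + 1}. real (J n) \<le> (\<beta> + 1 / real n) * real j \<and>
          (\<forall>m. \<lfloor>2 ^ j * f y $ m\<rfloor> = 2 ^ (j - J n) * \<lfloor>2 ^ J n * f y $ m\<rfloor>)"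
        "\<And>t. 0 \<le> t \<Longrightarrow> t < D \<Longrightarrow> \<exists>C>0. \<forall>m. (1 / 2 ^ h m) ^ CARD('d) \<le> C * 2 powr (- t * real m)"
        using exists_dyadic_approximation_map[OF J(1) \<beta>, where ?'d = 'd, of M] unfolding D_\<beta> by blast
      define S where "S = ball x0 (e / 2)"
      have f_B: "f y \<in> B" if y: "y \<in> S" for y
      proof -
        have "norm (f y - y) \<le> (\<Sum>i\<in>UNIV. \<bar>(f y - y) $ i\<bar>)" by (rule norm_le_l1_cart)
        also have "\<dots> \<le> (\<Sum>i\<in>(UNIV :: 'd set). 1 / 2 ^ M)" using f(2) by (intro sum_mono) simp
        also have "\<dots> = d * (1 / 2) ^ M" by (simp add: d_def power_divide)
        finally have "dist y (f y) < e / 2" using M by (simp add: dist_norm norm_minus_commute)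
        then have "dist x0 (f y) < e"
          using y dist_triangle[of x0 "f y" y] by (simp add: S_def)
        then show ?thesis using x0(2) by auto
      qed
      have f_ge: "ereal \<gamma> \<le> div_exp \<psi> c (f y)" for y
        using lower[OF \<beta>(1) f(3)] unfolding \<gamma>_eq .
      \<comment> \<open>The half ball has positive measure, and \<open>f\<close> sends it to points
        of B with exponent at least \<gamma>. Discarding the negligible preimage of the larger
        exponents leaves equality.\<close>
      have large: "S \<inter> f -` F \<noteq> {} \<and> \<not> negligible (f -` F)" if "0 < D"
      proof -
        have bad: "negligible (f -` {x. div_exp \<psi> c x > ereal \<gamma>})"
          using that f(1,4) unfolding D_def by (intro negl) auto
        have S: "\<not> negligible S"
          unfolding S_def using x0(1) by (intro open_not_negligible) auto
        have sub: "S \<subseteq> f -` {x. div_exp \<psi> c x > ereal \<gamma>} \<union> (S \<inter> f -` F)"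
          using f_B f_ge by (auto simp: F_def less_le)
        have "\<not> negligible (S \<inter> f -` F)"
          using S bad sub negligible_Un negligible_subset by blast
        then show ?thesis
          using negligible_subset[of "f -` F" "S \<inter> f -` F"] by auto
      qed
      have F_ne: "F \<noteq> {}"
      \<comment> \<open>Nonemptiness matters separately, since \<open>dimH\<close> of the empty set
        is -\<infinity>. For D = 0 the upper bound on the exponent coincides with \<gamma>.\<close>
      proof (cases "D = 0")
        case True
        have "x0 \<in> S" using x0(1) by (simp add: S_def)
        moreover have "\<gamma> = dp - s" using \<gamma>_eq True by (simp add: \<beta>_def)
        ultimately have "f x0 \<in> F"
          using f_B f_ge[of x0] le[of "f x0"] by (simp add: F_def antisym)
        then show ?thesis by blast
      next
        case False
        then show ?thesis using large D(1) by auto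
      qed
      have lower_dim: "D \<le> t" if t: "0 \<le> t" "hausdorff_measure t F = 0" for t
      proof (rule ccontr)
        assume "\<not> D \<le> t"
        then have tD: "t < D" by simp
        have "t \<noteq> 0" using t(2) F_ne hausdorff_measure_0_eq_0 by blast
        then have t_pos: "0 < t" using t(1) by simp
        obtain C where C: "0 < C" "\<And>m. (1 / 2 ^ h m) ^ CARD('d) \<le> C * 2 powr (- t * real m)"
          using f(4)[OF t(1) tD] by blast
        have "negligible (f -` F)"
          by (rule negligible_vimage_hausdorff_null[OF t_pos t(2) f(1) C(2,1)])
        then show False using large t_pos tD by simp
      qed
      have upper_dim: "hausdorff_measure t F = 0" if t: "D < t" for t
      proof -
        \<comment> \<open>Lowering \<gamma> by \<eta> raises the dimension bound by (t - D)/2, which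
          still stays below t.\<close>
        define \<eta> where "\<eta> = (t - D) / (2 * r)"
        have \<eta>: "0 < \<eta>" "\<eta> * r = (t - D) / 2" using t finite by (auto simp: \<eta>_def)
        have "F \<subseteq> {x. ereal (\<gamma> - \<eta>) < div_exp \<psi> c x}" using \<eta>(1) by (auto simp: F_def)
        then have "hausdorff_measure t F \<le> hausdorff_measure t {x. ereal (\<gamma> - \<eta>) < div_exp \<psi> c x}"
          by (rule hausdorff_measure_mono)
        also have "\<dots> = 0"
        proof (rule null)
          show "0 < t" using t D(1) by simp
          have "d - s * r - (\<gamma> - \<eta>) * r = D + \<eta> * r" by (simp add: D_def algebra_simps)
          moreover have "D + (t - D) / 2 < t" using t by (simp add: field_simps)
          ultimately show "d - s * r - (\<gamma> - \<eta>) * r < t" unfolding \<eta>(2) by simp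
        qed
        finally show ?thesis by simp
      qed
      have "Inf (ereal ` {t. t \<ge> 0 \<and> hausdorff_measure t F = 0}) = ereal D"
      proof (rule antisym)
        show "Inf (ereal ` {t. t \<ge> 0 \<and> hausdorff_measure t F = 0}) \<le> ereal D"
        proof (rule dense_ge)
          fix z assume z: "ereal D < z"
          show "Inf (ereal ` {t. t \<ge> 0 \<and> hausdorff_measure t F = 0}) \<le> z"
          proof (cases z)
            case (real t)
            then show ?thesis using z upper_dim[of t] D(1) by (intro Inf_lower) auto
          qed (use z in auto)
        qed
        show "ereal D \<le> Inf (ereal ` {t. t \<ge> 0 \<and> hausdorff_measure t F = 0})"
          using lower_dim by (intro Inf_greatest) auto
      qed
      then show ?thesis
        using F_ne unfolding dimH_def F_def[symmetric] D_def by simp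
    qed
    have pr: "real_of_ereal p = r" "p \<noteq> \<infinity>" using finite by simp_all
    show ?thesis
      unfolding max_divergent_def dp_def[symmetric] d_def[symmetric] using ge le ae dim by (simp add: pr)
  qed
qed

theorem mainTheorem12:
  fixes \<psi> :: "'i::finite \<Rightarrow> real^'d::finite \<Rightarrow> complex"
    and s :: real and p q :: ereal
  assumes "0 < p" and "0 < q"
    and "bounded_fast_decaying \<psi>"
    and "dyadic_covering \<psi>"
  shows "b_residual s p q {c \<in> bspace s p q. max_divergent \<psi> s p c UNIV}"
proof -
  obtain C0 and T :: "('i \<times> nat \<times> (int^'d)) set" where C0: "0 < C0" and T: "finite T"
    and cov: "\<And>x. \<forall>m. 0 \<le> x $ m \<and> x $ m < 1 \<Longrightarrow> \<exists>(i, j, k)\<in>T. C0 \<le> cmod (wav \<psi> i j k x)"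
    using assms(4) unfolding dyadic_covering_def by blast
  \<comment> \<open>Indices start at 1 because density rests on a positive loss 1/n, whereas
    \<open>1 / real 0\<close> is 0.\<close>
  have "c \<in> bspace s p q \<and> max_divergent \<psi> s p c UNIV" if c: "c \<in> (\<Inter>n. enriched T s p q (Suc n))" for c
  proof -
    have mem: "c \<in> bspace s p q" using c by (auto simp: enriched_def)
    have "\<exists>J. 1 \<le> n \<longrightarrow> n \<le> J \<and> enriched_at T s (d_over_p TYPE('d) p) n J c" for n
    proof (cases n)
      case (Suc k)
      then show ?thesis using c by (auto simp: enriched_def)
    qed simp
    then obtain J where J: "\<And>n. 1 \<le> n \<Longrightarrow> n \<le> J n \<and> enriched_at T s (d_over_p TYPE('d) p) n (J n) c"
      by metis
    have "max_divergent \<psi> s p c UNIV"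
      by (rule max_divergent_of_enriched[OF assms(1-3) mem C0 cov, where J = J]) (use J in auto)
    with mem show ?thesis by blast
  qed
  then show ?thesis
    unfolding b_residual_def using b_open_enriched[OF assms(1,2) T] b_dense_enriched[OF assms(1,2) T]
    by (intro exI[of _ "\<lambda>n. enriched T s p q (Suc n)"]) auto
qed

end
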